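(* Let $z:\mathbb Z\setminus\{0\}\to\mathbb Z$ be defined by $$z(t)=(1-t^2)+\sum_{n=1}^\infty 2\Big[\prod_{m=2}^{n}\Big(1+2\prod_{k=2}^m k^{2m^m}\Big)\Big]\prod_{k=1}^{n+1}\Big(k^{2(n+1)^n}-t^{2(n+1)^n}\Big)^{n+1}$$ (for each $t\neq 0$ only finitely many terms are nonzero; the empty product over $m$ for $n=1$ equals $1$). Then $z$ is a smooth function on the absorbing subset $\mathbb Z\setminus\{0\}$ of $\mathbb Z$, i.e. $z\in C^\infty(\mathbb Z\setminus\{0\})$, and $z$ does not admit any smooth extension to $\mathbb Z$, i.e. there is no $\overline z\in C^\infty(\mathbb Z)$ with $\overline z|_{\mathbb Z\setminus\{0\}}=z$.
   Context: Conventions on algebras. $R$ is a commutative ring with $1$ (here $R=\mathbb Z$). An $R$-algebra is an associative commutative $R$-algebra $\mathcal A$ with identity $e$ such that $\lambda e=0$ ($\lambda\in R$) implies $\lambda=0$; homomorphisms preserve identities and subalgebras contain $e$. For a submodule $A\subset\mathcal A$ and $n\ge1$, $A^n$ (resp. $\underline A^n$) is the submodule (resp. ideal) of $\mathcal A$ generated by all products of $n$ elements of $A$; $\underline A=\underline A^1$. An ideal $\Lambda$ of $\mathcal A$ is of type $C$ if $\mathcal A=Re\oplus\Lambda$; $\mathcal A^c$ is the set of such ideals, and $\pi_\Lambda:\mathcal A\to\Lambda$ is the corresponding projection. A submodule $A$ is of type $C$ ($A\in C(\mathcal A)$) if $\underline A\in\mathcal A^c$ and every submodule $B\subset A$ with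 $\underline B\in\mathcal A^c$ equals $A$. $A\in C(\mathcal A)$ is of type $D$ ($A\in D(\mathcal A)$) if $A^k\cap\underline A^{k+1}=\{0\}$ for all $k\ge1$. For $A,B\in C(\mathcal A)$: $A\approx B$ means $\underline A=\underline B$; $A\sim B$ (strongly compatible) means $A\approx\pi_{\underline A}(B)$ and $B\approx\pi_{\underline B}(A)$; $A,B$ are compatible if there is a finite sequence $A=C_0\sim C_1\sim\dots\sim C_k=B$. A $C$-pair over $R$ is a pair $(\mathcal A,\Sigma)$ with $\mathcal A$ an $R$-algebra and $\emptyset\ne\Sigma\subset\mathcal A^c$. For $\Lambda\in\Sigma$, $\Lambda^\circ=\{A\in D(\mathcal A):\underline A=\Lambda\}$, and $\overline\Sigma=\bigcup_{\Lambda\in\Sigma}\Lambda^\circ$. It is a $D$-pair if $\Lambda^\circ\ne\emptyset$ for all $\Lambda\in\Sigma$, and a smooth pair if moreover any two elements of $\overline\Sigma$ are compatible. It is separated if $\bigcap_{\Lambda\in\Sigma}\Lambda=\{0\}$. A $C$-homomorphism $\varphi:(\mathcal A,\Sigma)\to(\mathcal A',\Sigma')$ is an algebra homomorphism $\mathcal A\to\mathcal A'$ with $\varphi^{-1}(\Lambda')\in\Sigma$ for all $\Lambda'\in\Sigma'$. An injective $C$-homomorphism between $D$-pairs is a domination if for each $\Lambda'\in\mathcal A'^c$ with $\varphi^{-1}(\Lambda')\in\Sigma$ one has $\Lambda'\in\Sigma'$, and $\varphi(A)\in\Lambda'^\circ$ for every $A\in(\varphi^{-1}(\Lambda'))^\circ$.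 A separated smooth pair is separatedly maximal if every domination from it to a separated smooth pair is an isomorphism (of pairs, with $C$-homomorphisms as morphisms). $\Omega\subset R$ is absorbing with respect to $\lambda\in\Omega$ if for each $\alpha\in R$, $\alpha\ne\lambda$, there is $\beta\in R$ such that, if $\alpha\ne0$, then $\alpha\beta\ne0$ and $\lambda+\beta\alpha\in\Omega$; a non-empty $\Omega$ is absorbing if it is absorbing with respect to all its elements. A smooth structure on an absorbing $\Omega$ (for $R$ e.g. an integral domain which is not a field) is a smooth pair $(\mathcal A,\Sigma)$ such that: (i) $\mathcal A$ is a subalgebra of $R^\Omega$ and $\Sigma=\{I_\omega:\omega\in\Omega\}$ with $I_\omega=\{y\in\mathcal A:y(\omega)=0\}$; (ii) the inclusion map $x:\Omega\to R$ belongs to $\mathcal A$; (iii) $(\mathcal A,\Sigma)$ is separated; (iv) $(\mathcal A,\Sigma)$ is separatedly maximal. The paper establishes that there is exactly one smooth structure $(\mathcal A,\Sigma)$ on $\Omega$; its algebra $\mathcal A$ is denoted $C^\infty(\Omega)$ and its elements are called smooth functions on $\Omega$.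
   Formalization: Two definitions are corrected so that the smooth structure is unique: separated maximality tests only dominations whose inverse images give all of Σ (targets taken up to isomorphism), and "x belongs to A" is strengthened to: R(x−ω) is of type D and generates I_ω for each ω. *)

theory Defs
  imports Complex_Main "HOL-Algebra.Module" "HOL-Algebra.Subrings" "HOL-Algebra.IntRing"
begin

section \<open>Algebras, powers of submodules\<close>

text \<open>
  The locale \<open>algebra\<close> of HOL-Algebra already means: associative commutative algebra with
  identity over a commutative ring with identity.
\<close>

definition unital_algebra ::
    "('r, 'm) ring_scheme \<Rightarrow> ('r, 'a, 'n) module_scheme \<Rightarrow> bool" where
  "unital_algebra R M \<longleftrightarrow> algebra R M \<and>
     (\<forall>r\<in>carrier R. r \<odot>\<^bsub>M\<^esub> \<one>\<^bsub>M\<^esub> = \<zero>\<^bsub>M\<^esub> \<longrightarrow> r = \<zero>\<^bsub>R\<^esub>)"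

definition subalg ::
    "('r, 'm) ring_scheme \<Rightarrow> ('r, 'a, 'n) module_scheme \<Rightarrow> 'a set \<Rightarrow> bool" where
  "subalg R M F \<longleftrightarrow> submodule F R M \<and> subring F M"

definition alg_hom ::
    "('r, 'm) ring_scheme \<Rightarrow> ('r, 'a, 'n) module_scheme \<Rightarrow> ('r, 'b, 'k) module_scheme
      \<Rightarrow> ('a \<Rightarrow> 'b) set" where
  "alg_hom R M M' = {\<phi> \<in> ring_hom M M'.
     \<forall>r\<in>carrier R. \<forall>x\<in>carrier M. \<phi> (r \<odot>\<^bsub>M\<^esub> x) = r \<odot>\<^bsub>M'\<^esub> \<phi> x}"

definition gen_submodule ::
    "('r, 'm) ring_scheme \<Rightarrow> ('r, 'a, 'n) module_scheme \<Rightarrow> 'a set \<Rightarrow> 'a set" where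
  "gen_submodule R M X = \<Inter>{N. submodule N R M \<and> X \<subseteq> N}"

definition products :: "('r, 'a, 'n) module_scheme \<Rightarrow> 'a set \<Rightarrow> nat \<Rightarrow> 'a set" where
  "products M A n = {finprod M f {..<n} | f. f \<in> {..<n} \<rightarrow> A}"

text \<open>\<open>mod_power\<close> is $A^n$ and \<open>ideal_power\<close> is $\underline A^n$.\<close>

definition mod_power ::
    "('r, 'm) ring_scheme \<Rightarrow> ('r, 'a, 'n) module_scheme \<Rightarrow> 'a set \<Rightarrow> nat \<Rightarrow> 'a set" where
  "mod_power R M A n = gen_submodule R M (products M A n)"

definition ideal_power :: "('r, 'a, 'n) module_scheme \<Rightarrow> 'a set \<Rightarrow> nat \<Rightarrow> 'a set" where
  "ideal_power M A n = Idl\<^bsub>M\<^esub> (products M A n)"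

abbreviation underline :: "('r, 'a, 'n) module_scheme \<Rightarrow> 'a set \<Rightarrow> 'a set" where
  "underline M A \<equiv> ideal_power M A 1"


section \<open>Types C and D, compatibility\<close>

definition scalars ::
    "('r, 'm) ring_scheme \<Rightarrow> ('r, 'a, 'n) module_scheme \<Rightarrow> 'a set" where
  "scalars R M = {r \<odot>\<^bsub>M\<^esub> \<one>\<^bsub>M\<^esub> | r. r \<in> carrier R}"

definition C_ideals ::
    "('r, 'm) ring_scheme \<Rightarrow> ('r, 'a, 'n) module_scheme \<Rightarrow> 'a set set" where
  "C_ideals R M = {L. ideal L M \<and>
     carrier M = scalars R M <+>\<^bsub>M\<^esub> L \<and> scalars R M \<inter> L = {\<zero>\<^bsub>M\<^esub>}}"

definition C_proj ::
    "('r, 'm) ring_scheme \<Rightarrow> ('r, 'a, 'n) module_scheme \<Rightarrow> 'a set \<Rightarrow> 'a \<Rightarrow> 'a" where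
  "C_proj R M L x = (THE y. y \<in> L \<and> (\<exists>c\<in>scalars R M. x = c \<oplus>\<^bsub>M\<^esub> y))"

definition C_modules ::
    "('r, 'm) ring_scheme \<Rightarrow> ('r, 'a, 'n) module_scheme \<Rightarrow> 'a set set" where
  "C_modules R M = {A. submodule A R M \<and> underline M A \<in> C_ideals R M \<and>
     (\<forall>B. submodule B R M \<and> B \<subseteq> A \<and> underline M B \<in> C_ideals R M \<longrightarrow> B = A)}"

definition D_modules ::
    "('r, 'm) ring_scheme \<Rightarrow> ('r, 'a, 'n) module_scheme \<Rightarrow> 'a set set" where
  "D_modules R M = {A \<in> C_modules R M.
     \<forall>k\<ge>1. mod_power R M A k \<inter> ideal_power M A (k + 1) = {\<zero>\<^bsub>M\<^esub>}}"

text \<open>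
  The relation \<open>\<approx>\<close> is one between submodules of type C. Thus \<open>A \<approx> \<pi>(B)\<close> in the definition of
  strong compatibility includes the requirement that \<open>\<pi>(B)\<close> be of type C.
\<close>

definition C_equiv ::
    "('r, 'm) ring_scheme \<Rightarrow> ('r, 'a, 'n) module_scheme \<Rightarrow> 'a set \<Rightarrow> 'a set \<Rightarrow> bool" where
  "C_equiv R M A B \<longleftrightarrow> A \<in> C_modules R M \<and> B \<in> C_modules R M \<and> underline M A = underline M B"

definition strongly_compatible ::
    "('r, 'm) ring_scheme \<Rightarrow> ('r, 'a, 'n) module_scheme \<Rightarrow> 'a set \<Rightarrow> 'a set \<Rightarrow> bool" where
  "strongly_compatible R M A B \<longleftrightarrow> A \<in> C_modules R M \<and> B \<in> C_modules R M \<and>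
     C_equiv R M A (C_proj R M (underline M A) ` B) \<and>
     C_equiv R M B (C_proj R M (underline M B) ` A)"

definition compatible ::
    "('r, 'm) ring_scheme \<Rightarrow> ('r, 'a, 'n) module_scheme \<Rightarrow> 'a set \<Rightarrow> 'a set \<Rightarrow> bool" where
  "compatible R M A B \<longleftrightarrow> A \<in> C_modules R M \<and> B \<in> C_modules R M \<and>
     (strongly_compatible R M)\<^sup>*\<^sup>* A B"


section \<open>C-pairs, D-pairs, smooth pairs\<close>

definition C_pair ::
    "('r, 'm) ring_scheme \<Rightarrow> ('r, 'a, 'n) module_scheme \<Rightarrow> 'a set set \<Rightarrow> bool" where
  "C_pair R M S \<longleftrightarrow> unital_algebra R M \<and> S \<noteq> {} \<and> S \<subseteq> C_ideals R M"

text \<open>\<open>circ R M L\<close> is \<open>L\<degree>\<close>.\<close>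

definition circ ::
    "('r, 'm) ring_scheme \<Rightarrow> ('r, 'a, 'n) module_scheme \<Rightarrow> 'a set \<Rightarrow> 'a set set" where
  "circ R M L = {A \<in> D_modules R M. underline M A = L}"

definition D_pair ::
    "('r, 'm) ring_scheme \<Rightarrow> ('r, 'a, 'n) module_scheme \<Rightarrow> 'a set set \<Rightarrow> bool" where
  "D_pair R M S \<longleftrightarrow> C_pair R M S \<and> (\<forall>L\<in>S. circ R M L \<noteq> {})"

definition smooth_pair ::
    "('r, 'm) ring_scheme \<Rightarrow> ('r, 'a, 'n) module_scheme \<Rightarrow> 'a set set \<Rightarrow> bool" where
  "smooth_pair R M S \<longleftrightarrow> D_pair R M S \<and>
     (\<forall>A\<in>\<Union>(circ R M ` S). \<forall>B\<in>\<Union>(circ R M ` S). compatible R M A B)"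

definition separated :: "('r, 'a, 'n) module_scheme \<Rightarrow> 'a set set \<Rightarrow> bool" where
  "separated M S \<longleftrightarrow> \<Inter>S = {\<zero>\<^bsub>M\<^esub>}"

definition preim :: "('r, 'a, 'n) module_scheme \<Rightarrow> ('a \<Rightarrow> 'b) \<Rightarrow> 'b set \<Rightarrow> 'a set" where
  "preim M \<phi> L' = {x \<in> carrier M. \<phi> x \<in> L'}"

definition C_hom ::
    "('r, 'm) ring_scheme \<Rightarrow> ('r, 'a, 'n) module_scheme \<Rightarrow> 'a set set
      \<Rightarrow> ('r, 'b, 'k) module_scheme \<Rightarrow> 'b set set \<Rightarrow> ('a \<Rightarrow> 'b) \<Rightarrow> bool" where
  "C_hom R M S M' S' \<phi> \<longleftrightarrow> \<phi> \<in> alg_hom R M M' \<and> (\<forall>L'\<in>S'. preim M \<phi> L' \<in> S)"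

definition C_iso ::
    "('r, 'm) ring_scheme \<Rightarrow> ('r, 'a, 'n) module_scheme \<Rightarrow> 'a set set
      \<Rightarrow> ('r, 'b, 'k) module_scheme \<Rightarrow> 'b set set \<Rightarrow> ('a \<Rightarrow> 'b) \<Rightarrow> bool" where
  "C_iso R M S M' S' \<phi> \<longleftrightarrow> C_hom R M S M' S' \<phi> \<and>
     (\<exists>\<psi>. C_hom R M' S' M S \<psi> \<and>
        (\<forall>x\<in>carrier M. \<psi> (\<phi> x) = x) \<and> (\<forall>y\<in>carrier M'. \<phi> (\<psi> y) = y))"

definition domination ::
    "('r, 'm) ring_scheme \<Rightarrow> ('r, 'a, 'n) module_scheme \<Rightarrow> 'a set set
      \<Rightarrow> ('r, 'b, 'k) module_scheme \<Rightarrow> 'b set set \<Rightarrow> ('a \<Rightarrow> 'b) \<Rightarrow> bool" where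
  "domination R M S M' S' \<phi> \<longleftrightarrow> D_pair R M S \<and> D_pair R M' S' \<and>
     C_hom R M S M' S' \<phi> \<and> inj_on \<phi> (carrier M) \<and>
     (\<forall>L'\<in>C_ideals R M'. preim M \<phi> L' \<in> S \<longrightarrow>
        L' \<in> S' \<and> (\<forall>A\<in>circ R M (preim M \<phi> L'). \<phi> ` A \<in> circ R M' L'))"

text \<open>
  \<^item> Maximality is tested against dominations that lose no point of \<open>S\<close>, i.e. for which
    \<open>L' \<mapsto> \<phi>\<^sup>-\<^sup>1(L')\<close> maps \<open>S'\<close> onto \<open>S\<close>. Without this clause even a pair of classical or of
    integral smooth functions is never maximal: restriction to the complement of a point is
    injective and satisfies all clauses of \<open>domination\<close> as soon as some function on the
    complement does not extend (for the integers: \<open>z\<close> below and the point 0).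

  \<^item> The targets range over algebras with carrier inside the type \<open>'a set \<Rightarrow> 'r\<close>, which
    restricts the targets up to isomorphism only. Let \<open>\<phi>\<close> be a domination into a separated pair
    \<open>(M', S')\<close> over any type. For \<open>L' \<in> S'\<close> and \<open>A \<in> circ R M (preim M \<phi> L')\<close>, the ideal \<open>L'\<close>
    is generated by \<open>\<phi> ` A\<close>; hence \<open>L'\<close> is determined by \<open>preim M \<phi> L'\<close> and \<open>S'\<close> embeds into
    \<open>S\<close>. As \<open>\<Inter>S' = {\<zero>}\<close> and \<open>M' / L' \<cong> R\<close>, the map sending \<open>y\<close> to the family of its residues
    embeds \<open>carrier M'\<close> into the functions \<open>S' \<Rightarrow> R\<close>, so into \<open>'a set \<Rightarrow> 'r\<close>.
\<close>

definition separatedly_maximal ::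
    "('r, 'm) ring_scheme \<Rightarrow> ('r, 'a, 'n) module_scheme \<Rightarrow> 'a set set \<Rightarrow> bool" where
  "separatedly_maximal R M S \<longleftrightarrow>
     (\<forall>(M' :: ('r, 'a set \<Rightarrow> 'r) module) S' \<phi>.
        smooth_pair R M' S' \<and> separated M' S' \<and>
        domination R M S M' S' \<phi> \<and> preim M \<phi> ` S' = S \<longrightarrow>
        C_iso R M S M' S' \<phi>)"


section \<open>Smooth functions on absorbing sets\<close>

definition absorbing_at :: "('r, 'm) ring_scheme \<Rightarrow> 'r set \<Rightarrow> 'r \<Rightarrow> bool" where
  "absorbing_at R \<Omega> l \<longleftrightarrow> (\<forall>a\<in>carrier R. a \<noteq> l \<longrightarrow> (\<exists>b\<in>carrier R. a \<noteq> \<zero>\<^bsub>R\<^esub> \<longrightarrow>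
     a \<otimes>\<^bsub>R\<^esub> b \<noteq> \<zero>\<^bsub>R\<^esub> \<and> l \<oplus>\<^bsub>R\<^esub> b \<otimes>\<^bsub>R\<^esub> a \<in> \<Omega>))"

definition absorbing :: "('r, 'm) ring_scheme \<Rightarrow> 'r set \<Rightarrow> bool" where
  "absorbing R \<Omega> \<longleftrightarrow> \<Omega> \<subseteq> carrier R \<and> \<Omega> \<noteq> {} \<and> (\<forall>l\<in>\<Omega>. absorbing_at R \<Omega> l)"

text \<open>
  The algebra $R^\Omega$. Functions on \<open>\<Omega>\<close> are represented by extensional functions, so that
  equality in the algebra is equality on \<open>\<Omega>\<close>.
\<close>

definition fun_algebra :: "('r, 'm) ring_scheme \<Rightarrow> 'r set \<Rightarrow> ('r, 'r \<Rightarrow> 'r) module" where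
  "fun_algebra R \<Omega> =
     \<lparr>carrier = \<Omega> \<rightarrow>\<^sub>E carrier R,
      monoid.mult = (\<lambda>f g. \<lambda>t\<in>\<Omega>. f t \<otimes>\<^bsub>R\<^esub> g t),
      one = (\<lambda>t\<in>\<Omega>. \<one>\<^bsub>R\<^esub>),
      zero = (\<lambda>t\<in>\<Omega>. \<zero>\<^bsub>R\<^esub>),
      add = (\<lambda>f g. \<lambda>t\<in>\<Omega>. f t \<oplus>\<^bsub>R\<^esub> g t),
      smult = (\<lambda>r f. \<lambda>t\<in>\<Omega>. r \<otimes>\<^bsub>R\<^esub> f t)\<rparr>"

definition point_ideal :: "('r, 'm) ring_scheme \<Rightarrow> ('r \<Rightarrow> 'r) set \<Rightarrow> 'r \<Rightarrow> ('r \<Rightarrow> 'r) set" where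
  "point_ideal R F \<omega> = {y \<in> F. y \<omega> = \<zero>\<^bsub>R\<^esub>}"

text \<open>
  A smooth structure on \<open>\<Omega>\<close>; the algebra is given by its carrier \<open>F\<close>. That the inclusion map
  \<open>x\<close> belongs to the algebra is understood in the sense that \<open>x\<close> is a smooth coordinate: at
  each point \<open>\<omega>\<close> the module \<open>R (x - \<omega>)\<close> is of type D and generates the ideal of \<open>\<omega>\<close>. Mere
  membership of \<open>x\<close> does not determine the structure: if \<open>u : \<int> \<rightarrow> \<int>\<close> is transcendental
  over \<open>\<int>[x]\<close>, then \<open>\<int>[x, u]\<close> with the ideals of all points is a separated smooth pair, and
  Zorn's lemma enlarges it to a separatedly maximal one in which all modules of type D over
  points have rank 2.
\<close>

definition smooth_structure ::
    "('r, 'm) ring_scheme \<Rightarrow> 'r set \<Rightarrow> ('r \<Rightarrow> 'r) set \<Rightarrow> ('r \<Rightarrow> 'r) set set \<Rightarrow> bool" where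
  "smooth_structure R \<Omega> F S \<longleftrightarrow>
     absorbing R \<Omega> \<and>
     subalg R (fun_algebra R \<Omega>) F \<and>
     (let M = (fun_algebra R \<Omega>)\<lparr>carrier := F\<rparr>; x = (\<lambda>t\<in>\<Omega>. t) in
        smooth_pair R M S \<and>
        S = point_ideal R F ` \<Omega> \<and>
        x \<in> F \<and>
        (\<forall>\<omega>\<in>\<Omega>. gen_submodule R M {x \<ominus>\<^bsub>M\<^esub> \<omega> \<odot>\<^bsub>M\<^esub> \<one>\<^bsub>M\<^esub>} \<in> circ R M (point_ideal R F \<omega>)) \<and>
        separated M S \<and>
        separatedly_maximal R M S)"

text \<open>\<open>C_infinity R \<Omega>\<close> is the algebra of the unique smooth structure on \<open>\<Omega>\<close>.\<close>

definition C_infinity :: "('r, 'm) ring_scheme \<Rightarrow> 'r set \<Rightarrow> ('r \<Rightarrow> 'r) set" where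
  "C_infinity R \<Omega> = (THE F. \<exists>S. smooth_structure R \<Omega> F S)"


section \<open>The function z\<close>

definition z_term :: "nat \<Rightarrow> int \<Rightarrow> int" where
  "z_term n t =
     2 * (\<Prod>m=2..n. 1 + 2 * (\<Prod>k=2..m. int k ^ (2 * m ^ m))) *
     (\<Prod>k=1..n + 1. (int k ^ (2 * (n + 1) ^ n) - t ^ (2 * (n + 1) ^ n)) ^ (n + 1))"

text \<open>
  For \<open>t \<noteq> 0\<close> almost all terms vanish, so \<open>suminf\<close> (with respect to the discrete topology of
  the integers) is the finite sum of the nonzero terms. The series starts at \<open>n = 1\<close>.
\<close>

definition z_fun :: "int \<Rightarrow> int" where
  "z_fun = (\<lambda>t\<in>UNIV - {0}. (1 - t ^ 2) + (\<Sum>n. z_term (Suc n) t))"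

end

theory Submission
  imports Defs "HOL-Computational_Algebra.Polynomial"
begin

text \<open>
  The algebra \<open>C\<^sup>\<infinity>(\<Omega>)\<close> is first made explicit. Call a function \<open>f\<close> on \<open>\<Omega>\<close> smooth if at each point
  \<open>\<omega>\<close> it is of the form \<open>f(\<omega>) + (x - \<omega>) g\<close> with \<open>g\<close> again smooth; this is read coinductively
  (\<open>smooth_functions\<close>). For infinite absorbing \<open>\<Omega>\<close> these functions are exactly \<open>C\<^sup>\<infinity>(\<Omega>)\<close>
  (\<open>C_infinity_eq\<close>), for the following reason.

  In any algebra in which every \<open>x - \<omega>\<close> generates an ideal of type C (\<open>coordinate_algebra\<close>), the
  modules of type D over the point \<open>\<omega>\<close> are the cyclic modules \<open>\<int>a\<close> with \<open>a\<close> and \<open>x - \<omega>\<close> dividing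
  each other (\<open>cyclic_generator_circ\<close>, \<open>circ_imp_cyclic\<close>). As the functions \<open>x - \<omega>\<close> differ by
  constants only, all these modules are compatible, and the points form a smooth pair. Moreover an
  injective homomorphism between two such algebras that respects the coordinates is a domination
  (\<open>domination_points\<close>), and conversely every domination onto the same points has such an algebra
  as its target (\<open>domination_coordinate\<close>). The values of an element of the target then form
  a smooth function, because the expansion \<open>y = y(\<omega>) e + (x - \<omega>) q\<close> can be repeated with \<open>q\<close>.
  This shows that the algebra of smooth functions is separatedly maximal, and that every other smooth
  structure is contained in it by a domination, hence equal to it.

  The function \<open>z\<close> is smooth on the nonzero integers because it is a series of polynomials whose
  order of vanishing at each nonzero integer tends to infinity; such a series can be divided by
  \<open>x - \<omega>\<close> term by term, with a series of the same kind as the result (\<open>polynomial_series_smooth\<close>).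

  It does not extend because its formal value at \<open>0\<close> is an infinite product. With
  \<open>p\<^sub>m = 2 (2 \<cdots> m)\<^sup>e\<close>, \<open>e = 2 m\<^sup>m\<close>, the terms of the series at \<open>0\<close> telescope to the product of the
  numbers \<open>1 + p\<^sub>m\<close>. An integer \<open>c\<close> that continues \<open>z\<close> even to first order would be congruent,
  modulo every \<open>T \<ge> 2\<close>, to a partial product with more and more factors. Taking for \<open>T\<close> the factors
  themselves forces \<open>c = 0\<close>, whereas all partial products are odd (\<open>z_no_extension\<close>).
\<close>

section \<open>Algebras over the integers\<close>

locale int_algebra = algebra "\<Z>" M for M :: "(int, 'a, 'n) module_scheme" (structure)
begin

lemma smult_carrier [simp, intro]: "y \<in> carrier M \<Longrightarrow> r \<odot> y \<in> carrier M"
  using smult_closed by simp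

lemma smult_add: "y \<in> carrier M \<Longrightarrow> (r + s) \<odot> y = r \<odot> y \<oplus> s \<odot> y"
  using smult_l_distr[of r s y] by simp

lemma smult_mult: "y \<in> carrier M \<Longrightarrow> (r * s) \<odot> y = r \<odot> (s \<odot> y)"
  using smult_assoc1[of r s y] by simp

lemma one_smult [simp]: "y \<in> carrier M \<Longrightarrow> 1 \<odot> y = y"
  using smult_one[of y] by simp

lemma zero_smult [simp]: "y \<in> carrier M \<Longrightarrow> 0 \<odot> y = \<zero>"
  using smult_l_null[of y] by simp

lemma uminus_smult: "y \<in> carrier M \<Longrightarrow> (- r) \<odot> y = \<ominus> (r \<odot> y)"
  using smult_add[of y "- r" r] minus_equality[of "- r \<odot> y" "r \<odot> y"] by simp

lemma smult_m_left: "y \<in> carrier M \<Longrightarrow> z \<in> carrier M \<Longrightarrow> r \<odot> y \<otimes> z = r \<odot> (y \<otimes> z)"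
  using smult_assoc2[of r y z] by simp

lemma smult_m_right: "y \<in> carrier M \<Longrightarrow> z \<in> carrier M \<Longrightarrow> y \<otimes> (r \<odot> z) = r \<odot> (y \<otimes> z)"
  using smult_m_left[of z y r] by (simp add: m_comm)

lemma smult_add_right:
  "y \<in> carrier M \<Longrightarrow> z \<in> carrier M \<Longrightarrow> r \<odot> (y \<oplus> z) = r \<odot> y \<oplus> r \<odot> z"
  using smult_r_distr[of r y z] by simp

lemma smult_eq_mult: "y \<in> carrier M \<Longrightarrow> r \<odot> y = (r \<odot> \<one>) \<otimes> y"
  by (simp add: smult_m_left)

lemma minus_eq_smult: "y \<in> carrier M \<Longrightarrow> z \<in> carrier M \<Longrightarrow> y \<ominus> z = y \<oplus> (- 1) \<odot> z"
  by (simp add: minus_eq uminus_smult)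

lemma add_neg_mid: "y \<in> carrier M \<Longrightarrow> z \<in> carrier M \<Longrightarrow> y \<oplus> (z \<oplus> \<ominus> y) = z"
  by (simp add: a_comm[of z] r_neg2)

lemma ideal_smult: "ideal L M \<Longrightarrow> y \<in> L \<Longrightarrow> r \<odot> y \<in> L"
  by (subst smult_eq_mult) (auto intro: ideal.Icarr ideal.I_l_closed)

lemma ideal_submodule: "ideal L M \<Longrightarrow> submodule L \<Z> M"
  by (rule submoduleI)
    (auto intro: ideal.Icarr additive_subgroup.zero_closed additive_subgroup.a_closed
      additive_subgroup.a_inv_closed ideal.axioms(1) ideal_smult)

text \<open>
  Additive inverses come for free, being multiplication by $-1$.
\<close>

lemma ideal_setI:
  assumes "N \<subseteq> carrier M" "\<zero> \<in> N" "\<And>y z. y \<in> N \<Longrightarrow> z \<in> N \<Longrightarrow> y \<oplus> z \<in> N"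
    "\<And>y r. y \<in> N \<Longrightarrow> r \<in> carrier M \<Longrightarrow> r \<otimes> y \<in> N"
  shows "ideal N M"
proof (rule idealI[OF ring_axioms])
  show "subgroup N (add_monoid M)"
  proof (rule add.subgroupI)
    fix y assume y: "y \<in> N"
    have "\<ominus> y = (\<ominus> \<one>) \<otimes> y" using y assms(1) by (simp add: l_minus subset_iff)
    then show "\<ominus> y \<in> N" using assms(4)[OF y, of "\<ominus> \<one>"] by simp
  qed (use assms in auto)
  fix a x assume a: "a \<in> N" "x \<in> carrier M"
  show "x \<otimes> a \<in> N" using assms(4) a by simp
  then show "a \<otimes> x \<in> N" using a assms(1) by (simp add: m_comm subset_iff)
qed

lemma PIdl_iff: "a \<in> carrier M \<Longrightarrow> y \<in> PIdl a \<longleftrightarrow> (\<exists>q\<in>carrier M. y = a \<otimes> q)"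
  unfolding cgenideal_def using m_comm by blast

lemma PIdl_smult: "a \<in> carrier M \<Longrightarrow> r \<odot> a \<in> PIdl a"
  using smult_m_right[of a \<one> r] by (auto simp: PIdl_iff intro!: bexI[of _ "r \<odot> \<one>"])

lemma submodule_range: "a \<in> carrier M \<Longrightarrow> submodule (range (\<lambda>r. r \<odot> a)) \<Z> M"
proof (rule submoduleI)
  assume a: "a \<in> carrier M"
  show "\<zero> \<in> range (\<lambda>r. r \<odot> a)" using a by (metis zero_smult rangeI)
qed (auto simp: smult_add[symmetric] smult_mult[symmetric] uminus_smult[symmetric])

lemma gen_submodule_singleton:
  assumes a: "a \<in> carrier M"
  shows "gen_submodule \<Z> M {a} = range (\<lambda>r. r \<odot> a)"
proof
  have "{a} \<subseteq> range (\<lambda>r. r \<odot> a)"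
    using one_smult[OF a] by (metis empty_subsetI insert_subset rangeI)
  then show "gen_submodule \<Z> M {a} \<subseteq> range (\<lambda>r. r \<odot> a)"
    unfolding gen_submodule_def using submodule_range[OF a] by blast
  show "range (\<lambda>r. r \<odot> a) \<subseteq> gen_submodule \<Z> M {a}"
    unfolding gen_submodule_def by (auto dest: submoduleE(4))
qed

lemma products_subset:
  assumes "A \<subseteq> carrier M" shows "products M A n \<subseteq> carrier M"
  unfolding products_def using assms by (auto intro!: finprod_closed)

lemma products_1:
  assumes "A \<subseteq> carrier M" shows "products M A 1 = A"
proof -
  have *: "finprod M f {..<1::nat} = f 0" if "f \<in> {..<1} \<rightarrow> A" for f
    using that assms by (auto simp: lessThan_Suc)
  have "y \<in> products M A 1" if "y \<in> A" for y
    unfolding products_def using that *[of "\<lambda>_. y"] by (auto intro!: exI[of _ "\<lambda>_. y"])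
  then show ?thesis unfolding products_def using * by auto
qed

lemma products_2:
  assumes "A \<subseteq> carrier M" "y \<in> A" "z \<in> A" shows "y \<otimes> z \<in> products M A 2"
proof -
  let ?f = "\<lambda>i::nat. if i = 0 then z else y"
  have "finprod M ?f {..<2} = y \<otimes> z"
    using assms by (auto simp: numeral_2_eq_2 lessThan_Suc subset_iff)
  then show ?thesis unfolding products_def using assms by (auto intro!: exI[of _ ?f])
qed

lemma gen_submodule_submodule: "submodule A \<Z> M \<Longrightarrow> gen_submodule \<Z> M A = A"
  unfolding gen_submodule_def by blast

lemma zero_in_submodule: "submodule A \<Z> M \<Longrightarrow> \<zero> \<in> A"
  using submodule.axioms(1)[of A \<Z> M] subgroup.one_closed[of A "add_monoid M"] by simp

lemma zero_in_mod_power: "\<zero> \<in> mod_power \<Z> M A n"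
  unfolding mod_power_def gen_submodule_def by (auto simp: zero_in_submodule)

lemma products_cyclic:
  assumes a: "a \<in> carrier M"
  shows "products M (range (\<lambda>r. r \<odot> a)) n \<subseteq> range (\<lambda>r. r \<odot> a [^] n)"
    and "a [^] n \<in> products M (range (\<lambda>r. r \<odot> a)) n"
proof -
  have "\<exists>c. finprod M f {..<n} = c \<odot> a [^] n" if "f \<in> {..<n} \<rightarrow> range (\<lambda>r. r \<odot> a)" for f
    using that
  proof (induction n)
    case (Suc n)
    obtain c where c: "finprod M f {..<n} = c \<odot> a [^] n" using Suc by (auto simp: Pi_iff less_SucI)
    obtain d where d: "f n = d \<odot> a" using Suc.prems by auto
    have "range (\<lambda>r. r \<odot> a) \<subseteq> carrier M" using a by auto
    then have "f \<in> {..<n} \<rightarrow> carrier M" using Suc.prems unfolding Pi_iff by (meson lessThan_iff less_SucI subsetD)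
    then have "finprod M f {..<Suc n} = f n \<otimes> finprod M f {..<n}"
      using d a by (simp add: lessThan_Suc)
    also have "\<dots> = (d * c) \<odot> a [^] Suc n"
      using a by (simp add: c d smult_m_left smult_m_right smult_mult[symmetric] m_comm mult.commute)
    finally show ?case by blast
  qed (use one_smult[OF one_closed] in \<open>auto intro!: exI[of _ 1]\<close>)
  then show "products M (range (\<lambda>r. r \<odot> a)) n \<subseteq> range (\<lambda>r. r \<odot> a [^] n)"
    unfolding products_def image_def by blast
  have "finprod M (\<lambda>_. a) {..<n} = a [^] n" using finprod_const[OF a, of "{..<n}"] by simp
  moreover have "a \<in> range (\<lambda>r. r \<odot> a)" using one_smult[OF a] by (metis rangeI)
  ultimately show "a [^] n \<in> products M (range (\<lambda>r. r \<odot> a)) n"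
    unfolding products_def by (intro CollectI exI[of _ "\<lambda>_. a"]) simp
qed

lemma mod_power_cyclic:
  assumes a: "a \<in> carrier M"
  shows "mod_power \<Z> M (range (\<lambda>r. r \<odot> a)) n \<subseteq> range (\<lambda>r. r \<odot> a [^] n)"
  unfolding mod_power_def gen_submodule_def
  using products_cyclic(1)[OF a, of n] submodule_range[of "a [^] n"] a by auto

lemma ideal_power_cyclic:
  assumes a: "a \<in> carrier M"
  shows "ideal_power M (range (\<lambda>r. r \<odot> a)) n = PIdl (a [^] n)"
proof
  have an: "a [^] n \<in> carrier M" using a by simp
  show "ideal_power M (range (\<lambda>r. r \<odot> a)) n \<subseteq> PIdl (a [^] n)"
    unfolding ideal_power_def
    using products_cyclic(1)[OF a, of n] PIdl_smult[OF an]
    by (intro genideal_minimal cgenideal_ideal an) auto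
  have "ideal (ideal_power M (range (\<lambda>r. r \<odot> a)) n) M"
    unfolding ideal_power_def using a by (intro genideal_ideal products_subset) auto
  moreover have "a [^] n \<in> ideal_power M (range (\<lambda>r. r \<odot> a)) n"
  proof -
    have "products M (range (\<lambda>r. r \<odot> a)) n \<subseteq> carrier M" using a by (intro products_subset) auto
    then show ?thesis
      unfolding ideal_power_def using products_cyclic(2)[OF a, of n] genideal_self by blast
  qed
  ultimately show "PIdl (a [^] n) \<subseteq> ideal_power M (range (\<lambda>r. r \<odot> a)) n"
    by (rule cgenideal_minimal)
qed

lemma underline_cyclic:
  assumes a: "a \<in> carrier M"
  shows "underline M (range (\<lambda>r. r \<odot> a)) = PIdl a"
  using ideal_power_cyclic[OF a, of 1] a by simp

lemma C_idealsI:
  assumes "ideal L M" "\<And>y. y \<in> carrier M \<Longrightarrow> \<exists>c. \<exists>l\<in>L. y = c \<odot> \<one> \<oplus> l"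
    "\<And>c. c \<odot> \<one> \<in> L \<Longrightarrow> c \<odot> \<one> = \<zero>"
  shows "L \<in> C_ideals \<Z> M"
proof -
  have "carrier M = scalars \<Z> M <+> L"
    using assms(2) ideal.Icarr[OF assms(1)] by (fastforce simp: scalars_def set_add_def')
  moreover have "\<zero> \<in> scalars \<Z> M \<inter> L"
    using zero_in_submodule[OF ideal_submodule[OF assms(1)]] zero_smult[OF one_closed]
    by (auto simp: scalars_def intro!: exI[of _ 0])
  ultimately show ?thesis using assms unfolding C_ideals_def scalars_def by blast
qed

lemma C_idealsD:
  assumes "L \<in> C_ideals \<Z> M"
  shows "ideal L M" "y \<in> carrier M \<Longrightarrow> \<exists>c. \<exists>l\<in>L. y = c \<odot> \<one> \<oplus> l"
    "c \<odot> \<one> \<in> L \<Longrightarrow> c \<odot> \<one> = \<zero>"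
  using assms unfolding C_ideals_def scalars_def set_add_def' by auto

text \<open>
  Two complements of the same submodule \<open>\<int>e\<close> cannot be properly nested (modular law). This is
  what turns every inclusion between ideals of type C below into an equality.
\<close>

lemma C_ideals_subset_eq:
  assumes "L \<in> C_ideals \<Z> M" "L' \<in> C_ideals \<Z> M" "L \<subseteq> L'"
  shows "L = L'"
proof
  show "L' \<subseteq> L"
  proof
    fix y assume y: "y \<in> L'"
    have yc: "y \<in> carrier M" using C_idealsD(1)[OF assms(2)] y by (rule ideal.Icarr)
    obtain c l where l: "l \<in> L" "y = c \<odot> \<one> \<oplus> l" using C_idealsD(2)[OF assms(1) yc] by blast
    have lc: "l \<in> carrier M" using C_idealsD(1)[OF assms(1)] l by (blast intro: ideal.Icarr)
    have "c \<odot> \<one> = y \<oplus> \<ominus> l"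
      unfolding l(2) using lc by (simp add: a_assoc r_neg)
    also have "\<dots> \<in> L'"
      using y l(1) assms(3) ideal_submodule[OF C_idealsD(1)[OF assms(2)]]
      by (meson submoduleE(3,5) subsetD)
    finally have "c \<odot> \<one> = \<zero>" by (rule C_idealsD(3)[OF assms(2)])
    then show "y \<in> L" using l lc by simp
  qed
qed (fact assms(3))

lemma C_proj_id:
  assumes L: "L \<in> C_ideals \<Z> M" and y: "y \<in> L"
  shows "C_proj \<Z> M L (c \<odot> \<one> \<oplus> y) = y"
  unfolding C_proj_def
proof (rule the_equality)
  show "y \<in> L \<and> (\<exists>s\<in>scalars \<Z> M. c \<odot> \<one> \<oplus> y = s \<oplus> y)" using y by (auto simp: scalars_def)
next
  fix z assume "z \<in> L \<and> (\<exists>s\<in>scalars \<Z> M. c \<odot> \<one> \<oplus> y = s \<oplus> z)"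
  then obtain d where z: "z \<in> L" and d: "c \<odot> \<one> \<oplus> y = d \<odot> \<one> \<oplus> z" by (auto simp: scalars_def)
  have yc: "y \<in> carrier M" and zc: "z \<in> carrier M"
    using C_idealsD(1)[OF L] y z by (auto intro: ideal.Icarr)
  have "(d - c) \<odot> \<one> = d \<odot> \<one> \<ominus> c \<odot> \<one>"
    using smult_add[of \<one> d "- c"] uminus_smult[of \<one> c] by (simp add: minus_eq)
  also have "\<dots> = y \<oplus> \<ominus> z"
  proof -
    have "y = \<ominus> (c \<odot> \<one>) \<oplus> (c \<odot> \<one> \<oplus> y)" using yc by (simp add: a_assoc[symmetric] l_neg)
    also have "\<dots> = \<ominus> (c \<odot> \<one>) \<oplus> (d \<odot> \<one> \<oplus> z)" by (simp add: d)
    finally have "y = \<ominus> (c \<odot> \<one>) \<oplus> (d \<odot> \<one> \<oplus> z)" .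
    then show ?thesis using zc by (simp add: minus_eq a_ac r_neg1 r_neg2)
  qed
  finally have eq: "(d - c) \<odot> \<one> = y \<oplus> \<ominus> z" .
  also have "\<dots> \<in> L"
    using y z ideal_submodule[OF C_idealsD(1)[OF L]] by (meson submoduleE(3,5))
  finally have "(d - c) \<odot> \<one> = \<zero>" by (rule C_idealsD(3)[OF L])
  then show "z = y" using eq yc zc
    by (metis minus_equality minus_minus a_inv_closed)
qed

end

section \<open>Algebras with a coordinate\<close>

text \<open>
  The common abstraction of all algebras in the argument: the algebras of functions on \<open>\<Omega>\<close>, their
  copies over other types, and the unknown targets of dominations. The two last assumptions say
  elementwise that \<open>x - \<omega>\<close> generates an ideal of type C: \<open>expand\<close> that the multiples of \<open>x - \<omega>\<close>
  together with \<open>\<int>e\<close> span everything, \<open>proper\<close> that they meet \<open>\<int>e\<close> only in zero. Injectivity of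
  \<open>\<int> \<rightarrow> \<int>e\<close> is the case \<open>q = 0\<close> of \<open>proper\<close>.
\<close>

locale coordinate_algebra = int_algebra M for M :: "(int, 'a, 'n) module_scheme" (structure) +
  fixes x :: 'a and \<Omega> :: "int set"
  assumes x_carrier [simp, intro]: "x \<in> carrier M"
    and infinite_points: "infinite \<Omega>"
    and expand: "\<lbrakk>\<omega> \<in> \<Omega>; y \<in> carrier M\<rbrakk> \<Longrightarrow>
      \<exists>c. \<exists>q\<in>carrier M. y = c \<odot> \<one> \<oplus> (x \<ominus> \<omega> \<odot> \<one>) \<otimes> q"
    and proper: "\<lbrakk>\<omega> \<in> \<Omega>; q \<in> carrier M; c \<odot> \<one> = (x \<ominus> \<omega> \<odot> \<one>) \<otimes> q\<rbrakk> \<Longrightarrow> c = 0"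
begin

definition shift :: "int \<Rightarrow> 'a" where
  "shift \<omega> = x \<ominus> \<omega> \<odot> \<one>"

text \<open>
  The ideal of the point \<open>\<omega>\<close>.
\<close>

definition pt :: "int \<Rightarrow> 'a set" where
  "pt \<omega> = PIdl (shift \<omega>)"

definition points :: "'a set set" where
  "points = pt ` \<Omega>"

text \<open>
  The residue of \<open>y\<close> modulo the ideal of the point \<open>\<omega>\<close>, thought of as the value of \<open>y\<close> at \<open>\<omega>\<close>.
\<close>

definition ev :: "int \<Rightarrow> 'a \<Rightarrow> int" where
  "ev \<omega> y = (THE c. \<exists>q\<in>carrier M. y = c \<odot> \<one> \<oplus> shift \<omega> \<otimes> q)"

lemma shift_carrier [simp, intro]: "shift \<omega> \<in> carrier M"
  by (simp add: shift_def)

lemma pt_iff: "y \<in> pt \<omega> \<longleftrightarrow> (\<exists>q\<in>carrier M. y = shift \<omega> \<otimes> q)"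
  by (simp add: pt_def PIdl_iff)

lemma ideal_pt: "ideal (pt \<omega>) M"
  by (simp add: pt_def cgenideal_ideal)

lemma diff_smult: "y \<in> carrier M \<Longrightarrow> (r - s) \<odot> y = r \<odot> y \<ominus> s \<odot> y"
  using smult_add[of y r "- s"] uminus_smult[of y s] by (simp add: minus_eq)

lemma ev_eqI:
  assumes w: "\<omega> \<in> \<Omega>" and q: "q \<in> carrier M" and y: "y = c \<odot> \<one> \<oplus> shift \<omega> \<otimes> q"
  shows "ev \<omega> y = c"
  unfolding ev_def
proof (rule the_equality)
  show "\<exists>q\<in>carrier M. y = c \<odot> \<one> \<oplus> shift \<omega> \<otimes> q" using q y by blast
next
  fix d assume "\<exists>q\<in>carrier M. y = d \<odot> \<one> \<oplus> shift \<omega> \<otimes> q"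
  then obtain p where p: "p \<in> carrier M" "y = d \<odot> \<one> \<oplus> shift \<omega> \<otimes> p" by blast
  have "(d - c) \<odot> \<one> = d \<odot> \<one> \<ominus> c \<odot> \<one>" by (simp add: diff_smult)
  also have "\<dots> = shift \<omega> \<otimes> q \<ominus> shift \<omega> \<otimes> p"
  proof -
    have "shift \<omega> \<otimes> q = \<ominus> (c \<odot> \<one>) \<oplus> (d \<odot> \<one> \<oplus> shift \<omega> \<otimes> p)"
      using q p y by (metis r_neg1 smult_carrier one_closed m_closed shift_carrier)
    then show ?thesis using p(1) by (simp add: minus_eq a_ac r_neg1 r_neg2 add_neg_mid)
  qed
  also have "\<dots> = shift \<omega> \<otimes> (q \<ominus> p)"
    using p q by (simp add: minus_eq r_distr r_minus)
  finally have "d - c = 0"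
    using proper[OF w, of "q \<ominus> p" "d - c"] p q by (simp add: shift_def)
  then show "d = c" by simp
qed

lemma ev_expand:
  assumes "\<omega> \<in> \<Omega>" "y \<in> carrier M"
  obtains q where "q \<in> carrier M" "y = ev \<omega> y \<odot> \<one> \<oplus> shift \<omega> \<otimes> q"
  using expand[OF assms] ev_eqI[OF assms(1)] by (auto simp: shift_def)

context
  fixes \<omega> assumes w: "\<omega> \<in> \<Omega>"
begin

lemma ev_const [simp]: "ev \<omega> (c \<odot> \<one>) = c"
  by (rule ev_eqI[OF w, of \<zero>]) auto

lemma ev_one [simp]: "ev \<omega> \<one> = 1"
  using ev_const[of 1] by simp

lemma ev_zero [simp]: "ev \<omega> \<zero> = 0"
  using ev_const[of 0] by simp

lemma ev_add [simp]:
  assumes "y \<in> carrier M" "z \<in> carrier M"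
  shows "ev \<omega> (y \<oplus> z) = ev \<omega> y + ev \<omega> z"
proof -
  obtain p where p: "p \<in> carrier M" "y = ev \<omega> y \<odot> \<one> \<oplus> shift \<omega> \<otimes> p" by (rule ev_expand[OF w assms(1)])
  obtain q where q: "q \<in> carrier M" "z = ev \<omega> z \<odot> \<one> \<oplus> shift \<omega> \<otimes> q" by (rule ev_expand[OF w assms(2)])
  have "y \<oplus> z = (ev \<omega> y \<odot> \<one> \<oplus> shift \<omega> \<otimes> p) \<oplus> (ev \<omega> z \<odot> \<one> \<oplus> shift \<omega> \<otimes> q)"
    using p q by simp
  also have "\<dots> = (ev \<omega> y + ev \<omega> z) \<odot> \<one> \<oplus> shift \<omega> \<otimes> (p \<oplus> q)"
    using p(1) q(1) by (simp add: smult_add r_distr a_ac)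
  finally have "y \<oplus> z = (ev \<omega> y + ev \<omega> z) \<odot> \<one> \<oplus> shift \<omega> \<otimes> (p \<oplus> q)" .
  then show ?thesis by (rule ev_eqI[OF w, rotated]) (use p(1) q(1) in simp)
qed

lemma ev_mult [simp]:
  assumes "y \<in> carrier M" "z \<in> carrier M"
  shows "ev \<omega> (y \<otimes> z) = ev \<omega> y * ev \<omega> z"
proof -
  obtain p where p: "p \<in> carrier M" "y = ev \<omega> y \<odot> \<one> \<oplus> shift \<omega> \<otimes> p" by (rule ev_expand[OF w assms(1)])
  obtain q where q: "q \<in> carrier M" "z = ev \<omega> z \<odot> \<one> \<oplus> shift \<omega> \<otimes> q" by (rule ev_expand[OF w assms(2)])
  have "y \<otimes> z = (ev \<omega> y \<odot> \<one> \<oplus> shift \<omega> \<otimes> p) \<otimes> z" using p by simp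
  also have "\<dots> = ev \<omega> y \<odot> z \<oplus> shift \<omega> \<otimes> (p \<otimes> z)"
    using p(1) assms(2) by (simp add: l_distr smult_m_left m_assoc)
  also have "\<dots> = ev \<omega> y \<odot> (ev \<omega> z \<odot> \<one> \<oplus> shift \<omega> \<otimes> q) \<oplus> shift \<omega> \<otimes> (p \<otimes> z)"
    using q by simp
  also have "\<dots> = (ev \<omega> y * ev \<omega> z) \<odot> \<one> \<oplus> shift \<omega> \<otimes> (ev \<omega> y \<odot> q \<oplus> p \<otimes> z)"
    using p(1) q(1) assms(2)
    by (simp add: smult_add_right smult_mult r_distr smult_m_right a_assoc)
  finally have "y \<otimes> z = (ev \<omega> y * ev \<omega> z) \<odot> \<one> \<oplus> shift \<omega> \<otimes> (ev \<omega> y \<odot> q \<oplus> p \<otimes> z)" .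
  then show ?thesis by (rule ev_eqI[OF w, rotated]) (use p(1) q(1) assms in simp)
qed

lemma ev_smult [simp]: "y \<in> carrier M \<Longrightarrow> ev \<omega> (c \<odot> y) = c * ev \<omega> y"
  by (subst smult_eq_mult) auto

lemma ev_pow [simp]: "y \<in> carrier M \<Longrightarrow> ev \<omega> (y [^] (n::nat)) = ev \<omega> y ^ n"
  by (induction n) auto

lemma ev_x [simp]: "ev \<omega> x = \<omega>"
  by (rule ev_eqI[OF w, of \<one>]) (simp_all add: shift_def minus_eq a_ac r_neg r_neg2)

lemma ev_shift [simp]: "ev \<omega> (shift \<omega>') = \<omega> - \<omega>'"
proof -
  have "shift \<omega>' = x \<oplus> (- \<omega>') \<odot> \<one>" by (simp add: shift_def minus_eq uminus_smult)
  then show ?thesis by simp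
qed

lemma pt_iff_ev: "y \<in> pt \<omega> \<longleftrightarrow> y \<in> carrier M \<and> ev \<omega> y = 0"
proof
  assume "y \<in> pt \<omega>" then show "y \<in> carrier M \<and> ev \<omega> y = 0" by (auto simp: pt_iff)
next
  assume y: "y \<in> carrier M \<and> ev \<omega> y = 0"
  obtain p where p: "p \<in> carrier M" "y = ev \<omega> y \<odot> \<one> \<oplus> shift \<omega> \<otimes> p"
    by (rule ev_expand[OF w, of y]) (use y in auto)
  then have "y = shift \<omega> \<otimes> p" using y by simp
  then show "y \<in> pt \<omega>" using p(1) by (auto simp: pt_iff)
qed

lemma pt_C_ideal: "pt \<omega> \<in> C_ideals \<Z> M"
proof (rule C_idealsI[OF ideal_pt])
  fix y assume "y \<in> carrier M"
  then obtain p where "p \<in> carrier M" "y = ev \<omega> y \<odot> \<one> \<oplus> shift \<omega> \<otimes> p"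
    by (rule ev_expand[OF w])
  then show "\<exists>c. \<exists>l\<in>pt \<omega>. y = c \<odot> \<one> \<oplus> l"
    by (intro exI[of _ "ev \<omega> y"] bexI[of _ "shift \<omega> \<otimes> p"]) (auto simp: pt_iff)
next
  fix c assume "c \<odot> \<one> \<in> pt \<omega>"
  then have "c = 0" by (simp add: pt_iff_ev)
  then show "c \<odot> \<one> = \<zero>" by simp
qed

end

text \<open>
  The differences \<open>\<omega>' - \<omega>\<close> are unbounded, so only \<open>0\<close> is divisible by all of them. This is how
  identities in the algebra are deduced from divisibilities between values at the other points.
\<close>

lemma dvd_all_points_zero:
  assumes "\<And>\<omega>'. \<omega>' \<in> \<Omega> \<Longrightarrow> \<omega>' \<noteq> \<omega> \<Longrightarrow> (\<omega>' - \<omega>) dvd (c::int)"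
  shows "c = 0"
proof (rule ccontr)
  assume c: "c \<noteq> 0"
  have "\<Omega> \<subseteq> insert \<omega> {\<omega> - \<bar>c\<bar>..\<omega> + \<bar>c\<bar>}"
  proof
    fix t assume t: "t \<in> \<Omega>"
    have "t = \<omega> \<or> \<bar>t - \<omega>\<bar> \<le> \<bar>c\<bar>" using assms[OF t] dvd_imp_le_int[OF c] by blast
    then show "t \<in> insert \<omega> {\<omega> - \<bar>c\<bar>..\<omega> + \<bar>c\<bar>}" by auto
  qed
  then show False using infinite_points finite_subset by blast
qed

lemma other_point: obtains \<omega>' where "\<omega>' \<in> \<Omega>" "\<omega>' \<noteq> \<omega>"
  using infinite_points by (metis finite.simps finite_subset subset_singleton_iff subsetI singletonI)

text \<open>
  Since \<open>a\<close> and \<open>x - \<omega>\<close> divide each other, the value of \<open>a\<close> at a point \<open>\<omega>' \<noteq> \<omega>\<close> is a nonzero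
  multiple of \<open>\<omega>' - \<omega>\<close>. An equation \<open>c a\<^sup>k = a\<^sup>k\<^sup>+\<^sup>1 q\<close> therefore makes \<open>c\<close> divisible by every
  \<open>\<omega>' - \<omega>\<close>, whence \<open>c = 0\<close>; this gives type D. For minimality, let \<open>B \<subseteq> \<int>a\<close> generate the ideal of
  \<open>\<omega>\<close> and let \<open>C\<close> be the ideal of integers \<open>c\<close> with \<open>ca \<in> B\<close>. The products \<open>a f\<close> with
  \<open>f(\<omega>) \<in> C\<close> form an ideal containing \<open>B\<close>, hence \<open>a = a f\<close> for such an \<open>f\<close>. Then \<open>f\<close> is \<open>1\<close> at
  all other points, so also at \<open>\<omega>\<close>, and \<open>1 \<in> C\<close>.
\<close>

lemma cyclic_generator_circ:
  assumes w: "\<omega> \<in> \<Omega>" and a: "a \<in> carrier M" and gen: "PIdl a = pt \<omega>"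
  shows "range (\<lambda>r. r \<odot> a) \<in> circ \<Z> M (pt \<omega>)"
proof -
  let ?A = "range (\<lambda>r. r \<odot> a)"
  have "a \<in> pt \<omega>" using cgenideal_self[OF a] gen by simp
  then obtain u where u: "u \<in> carrier M" "a = shift \<omega> \<otimes> u" by (auto simp: pt_iff)
  have "shift \<omega> \<in> PIdl a" using gen pt_iff_ev[OF w] w by simp
  then obtain v where v: "v \<in> carrier M" "shift \<omega> = a \<otimes> v" using a by (auto simp: PIdl_iff)
  have und: "underline M ?A = pt \<omega>" using underline_cyclic[OF a] gen by simp
  have "?A \<in> C_modules \<Z> M"
    unfolding C_modules_def
  proof (intro CollectI conjI allI impI)
    show "submodule ?A \<Z> M" by (rule submodule_range[OF a])
    show "underline M ?A \<in> C_ideals \<Z> M" using und pt_C_ideal[OF w] by simp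
    fix B assume B: "submodule B \<Z> M \<and> B \<subseteq> ?A \<and> underline M B \<in> C_ideals \<Z> M"
    have Bc: "B \<subseteq> carrier M" using B a by auto
    have idB: "underline M B = Idl B" using products_1[OF Bc] by (simp add: ideal_power_def)
    have "Idl B \<subseteq> pt \<omega>"
      using B PIdl_smult[OF a] gen by (intro genideal_minimal ideal_pt) auto
    then have eq: "Idl B = pt \<omega>"
      using C_ideals_subset_eq[of "Idl B" "pt \<omega>"] B idB pt_C_ideal[OF w] by simp
    define C where "C = {c. c \<odot> a \<in> B}"
    have Cadd: "c + d \<in> C" if "c \<in> C" "d \<in> C" for c d
      using that submoduleE(5)[of B] B a by (auto simp: C_def smult_add)
    have Cmul: "k * c \<in> C" if "c \<in> C" for k c
      using that submoduleE(4)[of B] B a by (auto simp: C_def smult_mult)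
    have C0: "0 \<in> C" using zero_in_submodule[of B] B a by (simp add: C_def)
    define J where "J = {a \<otimes> f |f. f \<in> carrier M \<and> ev \<omega> f \<in> C}"
    have "ideal J M"
    proof (rule ideal_setI)
      show "J \<subseteq> carrier M" using a by (auto simp: J_def)
      show "\<zero> \<in> J" using a w C0 by (auto simp: J_def intro!: exI[of _ \<zero>])
    next
      fix y z assume "y \<in> J" "z \<in> J"
      then obtain f g where "f \<in> carrier M" "ev \<omega> f \<in> C" "g \<in> carrier M" "ev \<omega> g \<in> C"
        "y = a \<otimes> f" "z = a \<otimes> g" by (auto simp: J_def)
      then show "y \<oplus> z \<in> J" using a w Cadd by (auto simp: J_def r_distr intro!: exI[of _ "f \<oplus> g"])
    next
      fix y r assume "y \<in> J" and r: "r \<in> carrier M"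
      then obtain f where "f \<in> carrier M" "ev \<omega> f \<in> C" "y = a \<otimes> f" by (auto simp: J_def)
      then show "r \<otimes> y \<in> J" using a w r Cmul by (auto simp: J_def m_lcomm intro!: exI[of _ "r \<otimes> f"])
    qed
    moreover have "B \<subseteq> J"
    proof
      fix b assume b: "b \<in> B"
      then obtain c where c: "b = c \<odot> a" using B by auto
      then have "c \<in> C" using b by (simp add: C_def)
      then show "b \<in> J" using a c w
        by (auto simp: J_def smult_m_right intro!: exI[of _ "c \<odot> \<one>"])
    qed
    ultimately have "Idl B \<subseteq> J" by (rule genideal_minimal)
    then have "a \<in> J" using eq \<open>a \<in> pt \<omega>\<close> by auto
    then obtain f where f: "f \<in> carrier M" "ev \<omega> f \<in> C" "a = a \<otimes> f" by (auto simp: J_def)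
    obtain q where q: "q \<in> carrier M" "f = ev \<omega> f \<odot> \<one> \<oplus> shift \<omega> \<otimes> q"
      by (rule ev_expand[OF w f(1)])
    have "1 - ev \<omega> f = 0"
    proof (rule dvd_all_points_zero[of \<omega>])
      fix \<omega>' assume w': "\<omega>' \<in> \<Omega>" "\<omega>' \<noteq> \<omega>"
      have av: "ev \<omega>' a * ev \<omega>' v = \<omega>' - \<omega>" using v a w' by (metis ev_mult ev_shift)
      have "ev \<omega>' a = ev \<omega>' a * ev \<omega>' f" using f a w' by (metis ev_mult)
      then have "ev \<omega>' f = 1" using av w'(2) by auto
      moreover have "ev \<omega>' f = ev \<omega> f + (\<omega>' - \<omega>) * ev \<omega>' q"
        using arg_cong[OF q(2), of "ev \<omega>'"] w'(1) q(1) by simp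
      ultimately have "1 - ev \<omega> f = (\<omega>' - \<omega>) * ev \<omega>' q" by simp
      then show "(\<omega>' - \<omega>) dvd (1 - ev \<omega> f)" by simp
    qed
    then have "1 \<in> C" using f(2) by simp
    then have "c \<in> C" for c using Cmul[of 1 c] by simp
    then show "B = ?A" using B by (auto simp: C_def)
  qed
  moreover have "mod_power \<Z> M ?A k \<inter> ideal_power M ?A (k + 1) = {\<zero>}" for k
  proof -
    have "\<zero> \<in> ideal_power M ?A (k + 1)"
      unfolding ideal_power_cyclic[OF a] using a by (auto simp: PIdl_iff intro!: bexI[of _ \<zero>])
    moreover have "b = \<zero>" if b: "b \<in> mod_power \<Z> M ?A k" "b \<in> ideal_power M ?A (k + 1)" for b
    proof -
      obtain c where c: "b = c \<odot> a [^] k" using b(1) mod_power_cyclic[OF a] by blast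
      obtain q where q: "q \<in> carrier M" "b = a [^] (k + 1) \<otimes> q"
        using b(2) a by (auto simp: ideal_power_cyclic[OF a] PIdl_iff)
      have "c = 0"
      proof (rule dvd_all_points_zero[of \<omega>])
        fix \<omega>' assume w': "\<omega>' \<in> \<Omega>" "\<omega>' \<noteq> \<omega>"
        have av: "ev \<omega>' a * ev \<omega>' v = \<omega>' - \<omega>" using v a w' by (metis ev_mult ev_shift)
        have au: "ev \<omega>' a = (\<omega>' - \<omega>) * ev \<omega>' u" using u w' by (metis ev_mult ev_shift shift_carrier)
        have "ev \<omega>' (c \<odot> a [^] k) = ev \<omega>' (a [^] (k + 1) \<otimes> q)" using c q(2) by simp
        then have "c * ev \<omega>' a ^ k = ev \<omega>' a ^ (k + 1) * ev \<omega>' q"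
          using a q(1) w' by (simp del: nat_pow_Suc)
        moreover have "ev \<omega>' a \<noteq> 0" using av w' by auto
        ultimately have "c = ev \<omega>' a * ev \<omega>' q" by simp
        then show "(\<omega>' - \<omega>) dvd c" using au by simp
      qed
      then show ?thesis using c a by simp
    qed
    ultimately show ?thesis using zero_in_mod_power by blast
  qed
  ultimately show ?thesis unfolding circ_def D_modules_def using und by simp
qed

end

context coordinate_algebra
begin

text \<open>
  Write \<open>L\<close> for the ideal of \<open>\<omega>\<close>. As \<open>A\<close> generates \<open>L\<close> and the algebra is \<open>\<int>e + L\<close>, one has
  \<open>L = A + I\<close>, where \<open>I\<close> is the ideal generated by the products of two elements of \<open>A\<close>. The
  quotient \<open>L / I\<close> is generated by the class of \<open>x - \<omega>\<close> because \<open>L L \<subseteq> I\<close>, and by type D the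
  module \<open>A\<close> embeds into it. So \<open>A\<close> is cyclic, generated by any \<open>a \<in> A\<close> in the class of \<open>x - \<omega>\<close>.
\<close>

lemma circ_imp_cyclic:
  assumes w: "\<omega> \<in> \<Omega>" and A: "A \<in> circ \<Z> M (pt \<omega>)"
  obtains a where "a \<in> carrier M" "A = range (\<lambda>r. r \<odot> a)" "PIdl a = pt \<omega>"
proof -
  have sub: "submodule A \<Z> M" and D: "mod_power \<Z> M A 1 \<inter> ideal_power M A (1 + 1) = {\<zero>}"
    using A unfolding circ_def D_modules_def C_modules_def by blast+
  have Ac: "A \<subseteq> carrier M" by (rule submoduleE(1)[OF sub])
  have und: "Idl A = pt \<omega>"
    using A products_1[OF Ac] unfolding circ_def ideal_power_def by simp
  have Apt: "A \<subseteq> pt \<omega>" using genideal_self[OF Ac] und by simp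
  define I where "I = ideal_power M A 2"
  have I: "ideal I M" unfolding I_def ideal_power_def by (intro genideal_ideal products_subset Ac)
  have I0: "\<zero> \<in> I" by (rule zero_in_submodule[OF ideal_submodule[OF I]])
  have Iadd: "y \<oplus> z \<in> I" if "y \<in> I" "z \<in> I" for y z
    by (rule submoduleE(5)[OF ideal_submodule[OF I] that])
  have Imul: "r \<otimes> y \<in> I" if "y \<in> I" "r \<in> carrier M" for y r
    by (rule ideal.I_l_closed[OF I that])
  have AI: "A \<inter> I = {\<zero>}"
    using D gen_submodule_submodule[OF sub] products_1[OF Ac]
    by (simp add: mod_power_def I_def numeral_2_eq_2)
  have prod_pt: "y \<otimes> z \<in> I" if "y \<in> pt \<omega>" "z \<in> pt \<omega>" for y z
  proof -
    have *: "y \<otimes> a \<in> I" if y: "y \<in> pt \<omega>" and a: "a \<in> A" for y a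
    proof -
      have ac: "a \<in> carrier M" using a Ac by auto
      have "Idl A \<subseteq> {y \<in> carrier M. y \<otimes> a \<in> I}"
      proof (rule genideal_minimal)
        show "ideal {y \<in> carrier M. y \<otimes> a \<in> I} M"
          by (rule ideal_setI) (auto simp: ac I0 l_distr Iadd m_assoc Imul)
        show "A \<subseteq> {y \<in> carrier M. y \<otimes> a \<in> I}"
        proof
          fix b assume b: "b \<in> A"
          have "b \<otimes> a \<in> I"
            using products_2[OF Ac b a] genideal_self[OF products_subset[OF Ac, of 2]]
            unfolding I_def ideal_power_def by blast
          then show "b \<in> {y \<in> carrier M. y \<otimes> a \<in> I}" using b Ac by auto
        qed
      qed
      then show ?thesis using y und by auto
    qed
    have yc: "y \<in> carrier M" using that pt_iff_ev[OF w] by simp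
    have "Idl A \<subseteq> {z \<in> carrier M. y \<otimes> z \<in> I}"
    proof (rule genideal_minimal)
      show "ideal {z \<in> carrier M. y \<otimes> z \<in> I} M"
        by (rule ideal_setI) (auto simp: yc I0 r_distr Iadd m_lcomm Imul)
      show "A \<subseteq> {z \<in> carrier M. y \<otimes> z \<in> I}" using *[OF that(1)] Ac by auto
    qed
    then show ?thesis using that(2) und by auto
  qed
  have "Idl A \<subseteq> {a \<oplus> s |a s. a \<in> A \<and> s \<in> I}" (is "_ \<subseteq> ?N")
  proof (rule genideal_minimal)
    show "ideal ?N M"
    proof (rule ideal_setI)
      show "?N \<subseteq> carrier M" using Ac ideal.Icarr[OF I] by auto
      show "\<zero> \<in> ?N" using zero_in_submodule[OF sub] I0 by (intro CollectI exI[of _ \<zero>]) auto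
    next
      fix y z assume "y \<in> ?N" "z \<in> ?N"
      then obtain a s b t where *: "y = a \<oplus> s" "a \<in> A" "s \<in> I" "z = b \<oplus> t" "b \<in> A" "t \<in> I" by blast
      then have "y \<oplus> z = (a \<oplus> b) \<oplus> (s \<oplus> t)"
        using Ac ideal.Icarr[OF I] by (simp add: a_ac subset_iff)
      moreover have "a \<oplus> b \<in> A" by (rule submoduleE(5)[OF sub *(2,5)])
      moreover have "s \<oplus> t \<in> I" using * Iadd by simp
      ultimately show "y \<oplus> z \<in> ?N" by blast
    next
      fix y r assume "y \<in> ?N" and r: "r \<in> carrier M"
      then obtain a s where *: "y = a \<oplus> s" "a \<in> A" "s \<in> I" by blast
      have c: "a \<in> carrier M" "s \<in> carrier M" using * Ac ideal.Icarr[OF I] by auto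
      obtain q where q: "q \<in> carrier M" "r = ev \<omega> r \<odot> \<one> \<oplus> shift \<omega> \<otimes> q" by (rule ev_expand[OF w r])
      have "r \<otimes> y = (ev \<omega> r \<odot> \<one> \<oplus> shift \<omega> \<otimes> q) \<otimes> a \<oplus> r \<otimes> s"
        using c r q(2) *(1) by (simp add: r_distr)
      also have "\<dots> = ev \<omega> r \<odot> a \<oplus> (q \<otimes> (shift \<omega> \<otimes> a) \<oplus> r \<otimes> s)"
        using c r q(1) by (simp add: l_distr smult_m_left m_assoc m_lcomm a_assoc)
      finally have eq: "r \<otimes> y = ev \<omega> r \<odot> a \<oplus> (q \<otimes> (shift \<omega> \<otimes> a) \<oplus> r \<otimes> s)" .
      have "shift \<omega> \<in> pt \<omega>" using pt_iff_ev[OF w] w by simp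
      then have "q \<otimes> (shift \<omega> \<otimes> a) \<oplus> r \<otimes> s \<in> I"
        using prod_pt[of "shift \<omega>" a] Apt *(2,3) q(1) r Iadd Imul by auto
      moreover have "ev \<omega> r \<odot> a \<in> A" using submoduleE(4)[OF sub, of "ev \<omega> r" a] *(2) by simp
      ultimately show "r \<otimes> y \<in> ?N" using eq by blast
    qed
    show "A \<subseteq> ?N"
    proof
      fix b assume "b \<in> A"
      then show "b \<in> ?N" using I0 Ac by (intro CollectI exI[of _ b] exI[of _ \<zero>]) auto
    qed
  qed
  moreover have sh: "shift \<omega> \<in> pt \<omega>" using pt_iff_ev[OF w] w by simp
  ultimately obtain a s where as: "a \<in> A" "s \<in> I" "shift \<omega> = a \<oplus> s" using und by blast
  have ac: "a \<in> carrier M" and sc: "s \<in> carrier M" using as Ac ideal.Icarr[OF I] by auto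
  have "A \<subseteq> range (\<lambda>r. r \<odot> a)"
  proof
    fix b assume b: "b \<in> A"
    then have "b \<in> pt \<omega>" using Apt by blast
    then obtain q where q: "q \<in> carrier M" "b = shift \<omega> \<otimes> q" by (auto simp: pt_iff)
    obtain p where p: "p \<in> carrier M" "q = ev \<omega> q \<odot> \<one> \<oplus> shift \<omega> \<otimes> p" by (rule ev_expand[OF w q(1)])
    have bc: "b \<in> carrier M" using b Ac by auto
    let ?c = "ev \<omega> q"
    have "b = shift \<omega> \<otimes> (?c \<odot> \<one> \<oplus> shift \<omega> \<otimes> p)" using q p by simp
    also have "\<dots> = ?c \<odot> shift \<omega> \<oplus> p \<otimes> (shift \<omega> \<otimes> shift \<omega>)"
      using p(1) by (simp add: r_distr smult_m_right m_ac)
    also have "\<dots> = ?c \<odot> a \<oplus> (?c \<odot> s \<oplus> p \<otimes> (shift \<omega> \<otimes> shift \<omega>))"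
      unfolding as(3) using ac sc p(1) by (simp add: smult_add_right a_assoc)
    finally have eq: "b = ?c \<odot> a \<oplus> (?c \<odot> s \<oplus> p \<otimes> (shift \<omega> \<otimes> shift \<omega>))" .
    have "\<ominus> (?c \<odot> a) \<oplus> b = ?c \<odot> s \<oplus> p \<otimes> (shift \<omega> \<otimes> shift \<omega>)"
      by (subst eq) (use ac sc p(1) in \<open>simp add: r_neg1\<close>)
    also have "\<dots> \<in> I" using prod_pt[OF sh sh] Imul p(1) Iadd ideal_smult[OF I as(2)] by simp
    finally have "\<ominus> (?c \<odot> a) \<oplus> b \<in> I" .
    moreover have "\<ominus> (?c \<odot> a) \<oplus> b \<in> A"
      using submoduleE(3,5)[OF sub] submoduleE(4)[OF sub, of ?c a] as(1) b by simp
    ultimately have "\<ominus> (?c \<odot> a) \<oplus> b = \<zero>" using AI by auto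
    then have "b = ?c \<odot> a" using bc ac minus_equality[of "\<ominus> (?c \<odot> a)" b]
      by (metis a_inv_closed minus_equality minus_minus smult_carrier)
    then show "b \<in> range (\<lambda>r. r \<odot> a)" by simp
  qed
  moreover have "range (\<lambda>r. r \<odot> a) \<subseteq> A" using submoduleE(4)[OF sub _ as(1)] by auto
  ultimately have "A = range (\<lambda>r. r \<odot> a)" by blast
  moreover from this have "PIdl a = pt \<omega>"
    using underline_cyclic[OF ac] A by (simp add: circ_def)
  ultimately show thesis using that ac by blast
qed

lemma unital: "unital_algebra \<Z> M"
proof -
  obtain \<omega> where w: "\<omega> \<in> \<Omega>" by (rule other_point)
  have "r = 0" if "r \<odot> \<one> = \<zero>" for r using ev_const[OF w, of r] that w by simp
  then show ?thesis unfolding unital_algebra_def using algebra_axioms by simp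
qed

lemma shift_cyclic_circ: "\<omega> \<in> \<Omega> \<Longrightarrow> range (\<lambda>r. r \<odot> shift \<omega>) \<in> circ \<Z> M (pt \<omega>)"
  by (rule cyclic_generator_circ) (simp_all add: pt_def)

lemma D_pair_points: "D_pair \<Z> M points"
  unfolding D_pair_def C_pair_def points_def
  using unital pt_C_ideal shift_cyclic_circ infinite_points by auto

lemma C_proj_subset:
  assumes w: "\<omega> \<in> \<Omega>" and B: "B \<subseteq> pt \<omega>"
  shows "C_proj \<Z> M (pt \<omega>) ` B = B"
proof -
  have "C_proj \<Z> M (pt \<omega>) b = b" if "b \<in> B" for b
    using C_proj_id[OF pt_C_ideal[OF w], of b 0] B that ideal.Icarr[OF ideal_pt[of \<omega>]] by auto
  then show ?thesis by force
qed

text \<open>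
  The projection onto the ideal of \<open>\<omega>\<close> fixes both modules.
\<close>

lemma strongly_compatible_same_point:
  assumes w: "\<omega> \<in> \<Omega>" and A: "A \<in> circ \<Z> M (pt \<omega>)" and B: "B \<in> circ \<Z> M (pt \<omega>)"
  shows "strongly_compatible \<Z> M A B"
proof -
  have sub: "A' \<subseteq> pt \<omega>" "A' \<in> C_modules \<Z> M" "underline M A' = pt \<omega>" if "A' \<in> circ \<Z> M (pt \<omega>)" for A'
  proof -
    show "A' \<in> C_modules \<Z> M" "underline M A' = pt \<omega>"
      using that unfolding circ_def D_modules_def by auto
    then have "A' \<subseteq> carrier M" unfolding C_modules_def using submoduleE(1) by auto
    then show "A' \<subseteq> pt \<omega>"
      using genideal_self products_1 \<open>underline M A' = pt \<omega>\<close> by (metis ideal_power_def)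
  qed
  show ?thesis
    unfolding strongly_compatible_def C_equiv_def
    using sub[OF A] sub[OF B] C_proj_subset[OF w] by simp
qed

text \<open>
  \<open>x - \<omega>'\<close> and \<open>x - \<omega>\<close> differ by a constant, which the projections remove.
\<close>

lemma strongly_compatible_shift:
  assumes w: "\<omega> \<in> \<Omega>" and w': "\<omega>' \<in> \<Omega>"
  shows "strongly_compatible \<Z> M (range (\<lambda>r. r \<odot> shift \<omega>)) (range (\<lambda>r. r \<odot> shift \<omega>'))"
proof -
  have proj: "C_proj \<Z> M (pt \<omega>) ` range (\<lambda>r. r \<odot> shift \<omega>') = range (\<lambda>r. r \<odot> shift \<omega>)"
    if w: "\<omega> \<in> \<Omega>" for \<omega> \<omega>'
  proof -
    have "C_proj \<Z> M (pt \<omega>) (r \<odot> shift \<omega>') = r \<odot> shift \<omega>" for r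
    proof -
      have "shift \<omega>' = (\<omega> - \<omega>') \<odot> \<one> \<oplus> shift \<omega>"
        by (simp add: shift_def diff_smult minus_eq a_ac r_neg1 r_neg2 add_neg_mid)
      then have "r \<odot> shift \<omega>' = (r * (\<omega> - \<omega>')) \<odot> \<one> \<oplus> r \<odot> shift \<omega>"
        by (simp add: smult_add_right smult_mult)
      moreover have "r \<odot> shift \<omega> \<in> pt \<omega>" using pt_iff_ev[OF w] w by simp
      ultimately show ?thesis using C_proj_id[OF pt_C_ideal[OF w]] by simp
    qed
    then show ?thesis by (simp add: image_image)
  qed
  have und: "underline M (range (\<lambda>r. r \<odot> shift \<omega>)) = pt \<omega>" for \<omega>
    using underline_cyclic by (simp add: pt_def)
  have C: "range (\<lambda>r. r \<odot> shift \<omega>) \<in> C_modules \<Z> M" if "\<omega> \<in> \<Omega>" for \<omega>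
    using shift_cyclic_circ[OF that] unfolding circ_def D_modules_def by auto
  show ?thesis
    unfolding strongly_compatible_def C_equiv_def und proj[OF w] proj[OF w'] using C w w' by simp
qed

text \<open>
  Any two modules of type D over points are linked by a chain of length three that passes through
  the modules generated by \<open>x - \<omega>\<close> and \<open>x - \<omega>'\<close>.
\<close>

lemma smooth_pair_points: "smooth_pair \<Z> M points"
  unfolding smooth_pair_def
proof (intro conjI ballI)
  show "D_pair \<Z> M points" by (rule D_pair_points)
  fix A B assume "A \<in> \<Union> (circ \<Z> M ` points)" "B \<in> \<Union> (circ \<Z> M ` points)"
  then obtain \<omega> \<omega>' where w: "\<omega> \<in> \<Omega>" "A \<in> circ \<Z> M (pt \<omega>)" and w': "\<omega>' \<in> \<Omega>" "B \<in> circ \<Z> M (pt \<omega>')"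
    by (auto simp: points_def)
  have 1: "strongly_compatible \<Z> M A (range (\<lambda>r. r \<odot> shift \<omega>))"
    by (rule strongly_compatible_same_point[OF w shift_cyclic_circ[OF w(1)]])
  have 2: "strongly_compatible \<Z> M (range (\<lambda>r. r \<odot> shift \<omega>)) (range (\<lambda>r. r \<odot> shift \<omega>'))"
    by (rule strongly_compatible_shift[OF w(1) w'(1)])
  have 3: "strongly_compatible \<Z> M (range (\<lambda>r. r \<odot> shift \<omega>')) B"
    by (rule strongly_compatible_same_point[OF w'(1) shift_cyclic_circ[OF w'(1)] w'(2)])
  show "compatible \<Z> M A B"
    unfolding compatible_def
  proof (intro conjI)
    show "A \<in> C_modules \<Z> M" "B \<in> C_modules \<Z> M"
      using w(2) w'(2) by (auto simp: circ_def D_modules_def)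
    show "(strongly_compatible \<Z> M)\<^sup>*\<^sup>* A B"
      using 1 2 3 by (meson rtranclp.rtrancl_into_rtrancl rtranclp.rtrancl_refl)
  qed
qed

lemma Inter_points: "\<Inter> points = {y \<in> carrier M. \<forall>\<omega>\<in>\<Omega>. ev \<omega> y = 0}"
proof -
  obtain \<omega> where "\<omega> \<in> \<Omega>" by (rule other_point)
  then show ?thesis unfolding points_def using pt_iff_ev by auto
qed

lemma separated_iff:
  "separated M points \<longleftrightarrow> (\<forall>y\<in>carrier M. (\<forall>\<omega>\<in>\<Omega>. ev \<omega> y = 0) \<longrightarrow> y = \<zero>)"
  unfolding separated_def Inter_points by auto

end

section \<open>Homomorphisms and dominations\<close>

lemma alg_homD:
  assumes "\<phi> \<in> alg_hom \<Z> M M'"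
  shows "y \<in> carrier M \<Longrightarrow> \<phi> y \<in> carrier M'"
    "y \<in> carrier M \<Longrightarrow> z \<in> carrier M \<Longrightarrow> \<phi> (y \<oplus>\<^bsub>M\<^esub> z) = \<phi> y \<oplus>\<^bsub>M'\<^esub> \<phi> z"
    "y \<in> carrier M \<Longrightarrow> z \<in> carrier M \<Longrightarrow> \<phi> (y \<otimes>\<^bsub>M\<^esub> z) = \<phi> y \<otimes>\<^bsub>M'\<^esub> \<phi> z"
    "\<phi> \<one>\<^bsub>M\<^esub> = \<one>\<^bsub>M'\<^esub>"
    "y \<in> carrier M \<Longrightarrow> \<phi> (r \<odot>\<^bsub>M\<^esub> y) = r \<odot>\<^bsub>M'\<^esub> \<phi> y"
  using assms by (auto simp: alg_hom_def ring_hom_closed ring_hom_add ring_hom_mult ring_hom_one)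

lemma alg_hom_shift:
  assumes "int_algebra M" "int_algebra M'" "\<phi> \<in> alg_hom \<Z> M M'" "x \<in> carrier M"
  shows "\<phi> (x \<ominus>\<^bsub>M\<^esub> \<omega> \<odot>\<^bsub>M\<^esub> \<one>\<^bsub>M\<^esub>) = \<phi> x \<ominus>\<^bsub>M'\<^esub> \<omega> \<odot>\<^bsub>M'\<^esub> \<one>\<^bsub>M'\<^esub>"
proof -
  interpret A: int_algebra M by fact
  interpret B: int_algebra M' by fact
  show ?thesis
    using assms(4) alg_homD[OF assms(3)] by (simp add: A.minus_eq_smult B.minus_eq_smult)
qed

locale coordinate_hom = A: coordinate_algebra M x \<Omega> + B: coordinate_algebra M' x' \<Omega>
  for M :: "(int, 'a, 'n) module_scheme" and x and \<Omega>
    and M' :: "(int, 'b, 'k) module_scheme" and x' +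
  fixes \<phi> :: "'a \<Rightarrow> 'b"
  assumes hom: "\<phi> \<in> alg_hom \<Z> M M'" and hom_x: "\<phi> x = x'"
begin

lemmas hom_simps = alg_homD[OF hom]

lemma hom_shift: "\<phi> (A.shift \<omega>) = B.shift \<omega>"
  using alg_hom_shift[OF A.int_algebra_axioms B.int_algebra_axioms hom A.x_carrier]
  by (simp add: A.shift_def B.shift_def hom_x)

lemma ev_hom:
  assumes "\<omega> \<in> \<Omega>" "y \<in> carrier M" shows "B.ev \<omega> (\<phi> y) = A.ev \<omega> y"
proof -
  obtain q where q: "q \<in> carrier M" "y = A.ev \<omega> y \<odot>\<^bsub>M\<^esub> \<one>\<^bsub>M\<^esub> \<oplus>\<^bsub>M\<^esub> A.shift \<omega> \<otimes>\<^bsub>M\<^esub> q"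
    by (rule A.ev_expand[OF assms])
  have "\<phi> y = \<phi> (A.ev \<omega> y \<odot>\<^bsub>M\<^esub> \<one>\<^bsub>M\<^esub> \<oplus>\<^bsub>M\<^esub> A.shift \<omega> \<otimes>\<^bsub>M\<^esub> q)" using q(2) by simp
  also have "\<dots> = A.ev \<omega> y \<odot>\<^bsub>M'\<^esub> \<one>\<^bsub>M'\<^esub> \<oplus>\<^bsub>M'\<^esub> B.shift \<omega> \<otimes>\<^bsub>M'\<^esub> \<phi> q"
    using q(1) by (simp add: hom_simps hom_shift)
  finally show ?thesis by (rule B.ev_eqI[OF assms(1), rotated]) (use q(1) hom_simps in auto)
qed

lemma preim_pt: "\<omega> \<in> \<Omega> \<Longrightarrow> preim M \<phi> (B.pt \<omega>) = A.pt \<omega>"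
  unfolding preim_def by (auto simp: A.pt_iff_ev B.pt_iff_ev ev_hom hom_simps)

lemma preim_points: "preim M \<phi> ` B.points = A.points"
  unfolding A.points_def B.points_def image_image by (intro image_cong preim_pt refl)

lemma hom_cyclic:
  assumes "a \<in> carrier M"
  shows "\<phi> ` range (\<lambda>r. r \<odot>\<^bsub>M\<^esub> a) = range (\<lambda>r. r \<odot>\<^bsub>M'\<^esub> \<phi> a)"
  using assms by (simp add: image_image hom_simps)

text \<open>
  An ideal of type C that pulls back to the ideal of \<open>\<omega>\<close> contains \<open>\<phi>(x - \<omega>) = x' - \<omega>\<close>, hence the
  ideal of \<open>\<omega>\<close> in the target, hence equals it. A module of type D over \<open>\<omega>\<close> is \<open>\<int>a\<close> with \<open>a\<close> and
  \<open>x - \<omega>\<close> dividing each other, a property that homomorphisms preserve.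
\<close>

lemma domination_points:
  assumes inj: "inj_on \<phi> (carrier M)"
  shows "domination \<Z> M A.points M' B.points \<phi>"
  unfolding domination_def C_hom_def
proof (intro conjI ballI impI)
  show "D_pair \<Z> M A.points" by (rule A.D_pair_points)
  show "D_pair \<Z> M' B.points" by (rule B.D_pair_points)
  show "\<phi> \<in> alg_hom \<Z> M M'" by (rule hom)
  show "inj_on \<phi> (carrier M)" by (rule inj)
  show "preim M \<phi> L' \<in> A.points" if "L' \<in> B.points" for L' using that preim_points by blast
next
  fix L' assume L': "L' \<in> C_ideals \<Z> M'" and pre: "preim M \<phi> L' \<in> A.points"
  then obtain \<omega> where w: "\<omega> \<in> \<Omega>" "preim M \<phi> L' = A.pt \<omega>" by (auto simp: A.points_def)
  have "A.shift \<omega> \<in> preim M \<phi> L'" using w A.pt_iff_ev by simp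
  then have "B.shift \<omega> \<in> L'" by (simp add: preim_def hom_shift)
  then have "B.pt \<omega> \<subseteq> L'"
    unfolding B.pt_def by (rule B.cgenideal_minimal[OF B.C_idealsD(1)[OF L']])
  then have eq: "L' = B.pt \<omega>"
    using B.C_ideals_subset_eq[OF B.pt_C_ideal[OF w(1)] L'] by simp
  show "L' \<in> B.points" using eq w by (simp add: B.points_def)
  fix A assume "A \<in> circ \<Z> M (preim M \<phi> L')"
  then have "A \<in> circ \<Z> M (A.pt \<omega>)" using w by simp
  then obtain a where a: "a \<in> carrier M" "A = range (\<lambda>r. r \<odot>\<^bsub>M\<^esub> a)" "PIdl\<^bsub>M\<^esub> a = A.pt \<omega>"
    by (rule A.circ_imp_cyclic[OF w(1)])
  have pa: "\<phi> a \<in> carrier M'" using a hom_simps by simp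
  have "A.shift \<omega> \<in> PIdl\<^bsub>M\<^esub> a" using a(3) w A.pt_iff_ev by simp
  then obtain v where v: "v \<in> carrier M" "A.shift \<omega> = a \<otimes>\<^bsub>M\<^esub> v"
    using A.PIdl_iff[OF a(1)] by blast
  then have "B.shift \<omega> = \<phi> a \<otimes>\<^bsub>M'\<^esub> \<phi> v" using a by (metis hom_shift hom_simps(3))
  then have "B.shift \<omega> \<in> PIdl\<^bsub>M'\<^esub> (\<phi> a)" using v hom_simps(1) B.PIdl_iff[OF pa] by blast
  then have "B.pt \<omega> \<subseteq> PIdl\<^bsub>M'\<^esub> (\<phi> a)"
    unfolding B.pt_def by (rule B.cgenideal_minimal[OF B.cgenideal_ideal[OF pa]])
  moreover have "a \<in> A.pt \<omega>" using a A.cgenideal_self by blast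
  then have "\<phi> a \<in> B.pt \<omega>" using w pa by (simp add: A.pt_iff_ev B.pt_iff_ev ev_hom)
  then have "PIdl\<^bsub>M'\<^esub> (\<phi> a) \<subseteq> B.pt \<omega>" by (rule B.cgenideal_minimal[OF B.ideal_pt])
  ultimately have "PIdl\<^bsub>M'\<^esub> (\<phi> a) = B.pt \<omega>" by simp
  then show "\<phi> ` A \<in> circ \<Z> M' L'"
    unfolding eq a(2) hom_cyclic[OF a(1)] by (rule B.cyclic_generator_circ[OF w(1) pa])
qed

lemma C_iso_points:
  assumes bij: "bij_betw \<phi> (carrier M) (carrier M')"
  shows "C_iso \<Z> M A.points M' B.points \<phi>"
proof -
  let ?\<psi> = "the_inv_into (carrier M) \<phi>"
  have inj: "inj_on \<phi> (carrier M)" and im: "\<phi> ` carrier M = carrier M'"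
    using bij by (auto simp: bij_betw_def)
  have left: "?\<psi> (\<phi> y) = y" if "y \<in> carrier M" for y using the_inv_into_f_f[OF inj that] .
  have right: "\<phi> (?\<psi> z) = z" if "z \<in> carrier M'" for z using f_the_inv_into_f[OF inj] that im by simp
  have cl: "?\<psi> z \<in> carrier M" if "z \<in> carrier M'" for z
    using the_inv_into_into[OF inj] that im by blast
  have "?\<psi> \<in> ring_hom M' M"
    by (rule ring_hom_memI)
      (auto intro!: inj_onD[OF inj] simp: cl right hom_simps)
  moreover have "?\<psi> (r \<odot>\<^bsub>M'\<^esub> z) = r \<odot>\<^bsub>M\<^esub> ?\<psi> z" if "z \<in> carrier M'" for r z
    using that by (auto intro!: inj_onD[OF inj] simp: cl right hom_simps)
  ultimately have h: "?\<psi> \<in> alg_hom \<Z> M' M" by (simp add: alg_hom_def)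
  have "preim M' ?\<psi> (A.pt \<omega>) = B.pt \<omega>" if w: "\<omega> \<in> \<Omega>" for \<omega>
  proof -
    have "B.ev \<omega> z = A.ev \<omega> (?\<psi> z)" if "z \<in> carrier M'" for z
      using ev_hom[OF w cl[OF that]] right[OF that] by simp
    then show ?thesis unfolding preim_def using w by (auto simp: A.pt_iff_ev B.pt_iff_ev cl)
  qed
  then have "C_hom \<Z> M' B.points M A.points ?\<psi>"
    using h by (auto simp: C_hom_def A.points_def B.points_def)
  moreover have "C_hom \<Z> M A.points M' B.points \<phi>"
    using hom preim_points by (auto simp: C_hom_def)
  ultimately show ?thesis unfolding C_iso_def using left right by blast
qed

end

text \<open>
  A domination carries \<open>\<int>(x - \<omega>)\<close> to a module of type D, so each ideal in \<open>S'\<close> is generated by some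
  \<open>\<phi>(x) - \<omega>\<close>. As these ideals are of type C, every element of the target has an expansion along
  \<open>\<phi>(x) - \<omega>\<close>, also outside the image of \<open>\<phi>\<close>.
\<close>

lemma domination_coordinate:
  fixes M :: "(int, 'a, 'n) module_scheme" and M' :: "(int, 'b, 'k) module_scheme"
  assumes M: "coordinate_algebra M x \<Omega>"
    and dom: "domination \<Z> M (coordinate_algebra.points M x \<Omega>) M' S' \<phi>"
    and onto: "preim M \<phi> ` S' = coordinate_algebra.points M x \<Omega>"
  shows "coordinate_hom M x \<Omega> M' (\<phi> x) \<phi>" "S' = coordinate_algebra.points M' (\<phi> x) \<Omega>"
proof -
  interpret A: coordinate_algebra M x \<Omega> by fact
  have un: "unital_algebra \<Z> M'" and SC: "S' \<subseteq> C_ideals \<Z> M'" and hom: "\<phi> \<in> alg_hom \<Z> M M'"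
    and circ: "\<And>L' A. L' \<in> S' \<Longrightarrow> A \<in> circ \<Z> M (preim M \<phi> L') \<Longrightarrow> \<phi> ` A \<in> circ \<Z> M' L'"
    using dom unfolding domination_def C_hom_def D_pair_def C_pair_def by blast+
  interpret B: int_algebra M'
    using un unfolding unital_algebra_def int_algebra_def by simp
  note h = alg_homD[OF hom]
  let ?s = "\<lambda>\<omega>. \<phi> x \<ominus>\<^bsub>M'\<^esub> \<omega> \<odot>\<^bsub>M'\<^esub> \<one>\<^bsub>M'\<^esub>"
  have sc: "?s \<omega> \<in> carrier M'" for \<omega> using h by simp
  have L'_eq: "L' = PIdl\<^bsub>M'\<^esub> (?s \<omega>)"
    if L': "L' \<in> S'" and w: "\<omega> \<in> \<Omega>" and pre: "preim M \<phi> L' = A.pt \<omega>" for L' \<omega>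
  proof -
    have "\<phi> ` range (\<lambda>r. r \<odot>\<^bsub>M\<^esub> A.shift \<omega>) \<in> circ \<Z> M' L'"
      using circ[OF L'] A.shift_cyclic_circ[OF w] pre by simp
    moreover have "\<phi> ` range (\<lambda>r. r \<odot>\<^bsub>M\<^esub> A.shift \<omega>) = range (\<lambda>r. r \<odot>\<^bsub>M'\<^esub> ?s \<omega>)"
      using alg_hom_shift[OF A.int_algebra_axioms B.int_algebra_axioms hom A.x_carrier]
      by (simp add: image_image h A.shift_def)
    ultimately show ?thesis using B.underline_cyclic[OF sc] by (simp add: circ_def)
  qed
  have ex: "PIdl\<^bsub>M'\<^esub> (?s \<omega>) \<in> S'" if w: "\<omega> \<in> \<Omega>" for \<omega>
  proof -
    have "A.pt \<omega> \<in> preim M \<phi> ` S'" using onto w by (simp add: A.points_def)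
    then show ?thesis using L'_eq[OF _ w] by auto
  qed
  have B: "coordinate_algebra M' (\<phi> x) \<Omega>"
  proof unfold_locales
    show "\<phi> x \<in> carrier M'" using h by simp
    show "infinite \<Omega>" by (rule A.infinite_points)
  next
    fix \<omega> y assume w: "\<omega> \<in> \<Omega>" and y: "y \<in> carrier M'"
    have "PIdl\<^bsub>M'\<^esub> (?s \<omega>) \<in> C_ideals \<Z> M'" using ex[OF w] SC by blast
    then show "\<exists>c. \<exists>q\<in>carrier M'. y = c \<odot>\<^bsub>M'\<^esub> \<one>\<^bsub>M'\<^esub> \<oplus>\<^bsub>M'\<^esub> ?s \<omega> \<otimes>\<^bsub>M'\<^esub> q"
      using B.C_idealsD(2)[OF _ y] B.PIdl_iff[OF sc] by metis
  next
    fix \<omega> q c assume w: "\<omega> \<in> \<Omega>" and q: "q \<in> carrier M'" and c: "c \<odot>\<^bsub>M'\<^esub> \<one>\<^bsub>M'\<^esub> = ?s \<omega> \<otimes>\<^bsub>M'\<^esub> q"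
    have "PIdl\<^bsub>M'\<^esub> (?s \<omega>) \<in> C_ideals \<Z> M'" using ex[OF w] SC by blast
    then have "c \<odot>\<^bsub>M'\<^esub> \<one>\<^bsub>M'\<^esub> = \<zero>\<^bsub>M'\<^esub>"
      using B.C_idealsD(3) B.PIdl_iff[OF sc] q c by metis
    then show "c = 0" using un by (simp add: unital_algebra_def)
  qed
  then interpret B: coordinate_algebra M' "\<phi> x" \<Omega> .
  show "coordinate_hom M x \<Omega> M' (\<phi> x) \<phi>"
    by unfold_locales (use hom in auto)
  show "S' = B.points"
  proof
    show "B.points \<subseteq> S'" using ex by (auto simp: B.points_def B.pt_def B.shift_def)
    show "S' \<subseteq> B.points"
    proof
      fix L' assume L': "L' \<in> S'"
      then have "preim M \<phi> L' \<in> A.points" using onto by blast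
      then obtain \<omega> where "\<omega> \<in> \<Omega>" "preim M \<phi> L' = A.pt \<omega>" by (auto simp: A.points_def)
      then show "L' \<in> B.points" using L'_eq[OF L'] by (auto simp: B.points_def B.pt_def B.shift_def)
    qed
  qed
qed

section \<open>Functions with iterated difference quotients\<close>

text \<open>
  The largest class of functions in which \<open>(f(t) - f(\<omega>)) / (t - \<omega>)\<close> extends over \<open>t = \<omega>\<close> to a member
  of the class, for every \<open>\<omega> \<in> \<Omega>\<close>. The definition has to be coinductive: the quotient must itself
  have quotients at all points, and so on without end.
\<close>

coinductive_set smooth_functions :: "int set \<Rightarrow> (int \<Rightarrow> int) set" for \<Omega> :: "int set" where
  smooth_functionsI: "\<lbrakk>f \<in> extensional \<Omega>;
    \<forall>\<omega>\<in>\<Omega>. \<exists>g. g \<in> smooth_functions \<Omega> \<and> (\<forall>t\<in>\<Omega>. f t = f \<omega> + (t - \<omega>) * g t)\<rbrakk>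
    \<Longrightarrow> f \<in> smooth_functions \<Omega>"

lemma smooth_functions_coinduct:
  assumes "f \<in> K" "\<And>f. f \<in> K \<Longrightarrow> f \<in> extensional \<Omega>"
    "\<And>f \<omega>. f \<in> K \<Longrightarrow> \<omega> \<in> \<Omega> \<Longrightarrow> \<exists>g\<in>K. \<forall>t\<in>\<Omega>. f t = f \<omega> + (t - \<omega>) * g t"
  shows "f \<in> smooth_functions \<Omega>"
  using assms(1)
proof (rule smooth_functions.coinduct)
  fix f assume f: "f \<in> K"
  have "\<forall>\<omega>\<in>\<Omega>. \<exists>g. (g \<in> K \<or> g \<in> smooth_functions \<Omega>) \<and> (\<forall>t\<in>\<Omega>. f t = f \<omega> + (t - \<omega>) * g t)"
    using assms(3)[OF f] by blast
  then show "\<exists>f'. f = f' \<and> f' \<in> extensional \<Omega> \<and>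
      (\<forall>\<omega>\<in>\<Omega>. \<exists>g. (g \<in> K \<or> g \<in> smooth_functions \<Omega>) \<and> (\<forall>t\<in>\<Omega>. f' t = f' \<omega> + (t - \<omega>) * g t))"
    using assms(2)[OF f] by (intro exI[of _ f]) simp
qed

lemma smooth_functions_extensional: "f \<in> smooth_functions \<Omega> \<Longrightarrow> f \<in> extensional \<Omega>"
  by (erule smooth_functions.cases) simp

lemma smooth_functions_quotient:
  assumes "f \<in> smooth_functions \<Omega>" "\<omega> \<in> \<Omega>"
  obtains g where "g \<in> smooth_functions \<Omega>" "\<And>t. t \<in> \<Omega> \<Longrightarrow> f t = f \<omega> + (t - \<omega>) * g t"
proof -
  from assms(1) show thesis
  proof cases
    case smooth_functionsI
    then show thesis using assms(2) that by blast
  qed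
qed

text \<open>
  An auxiliary class for coinduction up to the ring operations: the quotient of a product,
  \<open>f(\<omega>) g\<^sub>\<omega> + f\<^sub>\<omega> g\<close>, is not itself a product, so the closure properties are proved all at once.
\<close>

inductive_set generated :: "int set \<Rightarrow> (int \<Rightarrow> int) set" for \<Omega> :: "int set" where
  gen_base: "f \<in> smooth_functions \<Omega> \<Longrightarrow> f \<in> generated \<Omega>"
| gen_const: "(\<lambda>t\<in>\<Omega>. c) \<in> generated \<Omega>"
| gen_id: "(\<lambda>t\<in>\<Omega>. t) \<in> generated \<Omega>"
| gen_add: "\<lbrakk>f \<in> generated \<Omega>; g \<in> generated \<Omega>\<rbrakk> \<Longrightarrow> (\<lambda>t\<in>\<Omega>. f t + g t) \<in> generated \<Omega>"
| gen_mult: "\<lbrakk>f \<in> generated \<Omega>; g \<in> generated \<Omega>\<rbrakk> \<Longrightarrow> (\<lambda>t\<in>\<Omega>. f t * g t) \<in> generated \<Omega>"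

lemma generated_smooth: "generated \<Omega> = smooth_functions \<Omega>"
proof
  show "generated \<Omega> \<subseteq> smooth_functions \<Omega>"
  proof
    fix f assume "f \<in> generated \<Omega>"
    then show "f \<in> smooth_functions \<Omega>"
    proof (rule smooth_functions_coinduct)
      show "f \<in> extensional \<Omega>" if "f \<in> generated \<Omega>" for f
        using that by induction (simp_all only: restrict_extensional smooth_functions_extensional)
      show "\<exists>g\<in>generated \<Omega>. \<forall>t\<in>\<Omega>. f t = f \<omega> + (t - \<omega>) * g t"
        if "f \<in> generated \<Omega>" and w: "\<omega> \<in> \<Omega>" for f \<omega>
        using that(1)
      proof induction
        case (gen_base f)
        then show ?case using w by (metis generated.gen_base smooth_functions_quotient)
      next
        case (gen_const c)
        show ?case using w by (intro bexI[OF _ generated.gen_const[where c = 0]]) auto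
      next
        case gen_id
        show ?case using w by (intro bexI[OF _ generated.gen_const[where c = 1]]) auto
      next
        case (gen_add f g)
        then obtain p q where pq: "p \<in> generated \<Omega>" "q \<in> generated \<Omega>"
          "\<forall>t\<in>\<Omega>. f t = f \<omega> + (t - \<omega>) * p t" "\<forall>t\<in>\<Omega>. g t = g \<omega> + (t - \<omega>) * q t" by blast
        let ?h = "\<lambda>t\<in>\<Omega>. p t + q t"
        have "(\<lambda>t\<in>\<Omega>. f t + g t) t = (\<lambda>t\<in>\<Omega>. f t + g t) \<omega> + (t - \<omega>) * ?h t" if t: "t \<in> \<Omega>" for t
        proof -
          have "f t + g t = (f \<omega> + (t - \<omega>) * p t) + (g \<omega> + (t - \<omega>) * q t)" using pq(3,4) t by simp
          then show ?thesis unfolding restrict_apply'[OF t] restrict_apply'[OF w] by (simp add: algebra_simps)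
        qed
        then show ?case using generated.gen_add[OF pq(1,2)] by blast
      next
        case (gen_mult f g)
        then obtain p q where pq: "p \<in> generated \<Omega>" "q \<in> generated \<Omega>"
          "\<forall>t\<in>\<Omega>. f t = f \<omega> + (t - \<omega>) * p t" "\<forall>t\<in>\<Omega>. g t = g \<omega> + (t - \<omega>) * q t" by blast
        let ?h = "\<lambda>t\<in>\<Omega>. (\<lambda>t\<in>\<Omega>. (\<lambda>t\<in>\<Omega>. f \<omega>) t * q t) t + (\<lambda>t\<in>\<Omega>. p t * g t) t"
        have "?h \<in> generated \<Omega>"
          by (intro generated.gen_add generated.gen_mult generated.gen_const pq gen_mult.hyps)
        moreover have "(\<lambda>t\<in>\<Omega>. f t * g t) t = (\<lambda>t\<in>\<Omega>. f t * g t) \<omega> + (t - \<omega>) * ?h t"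
          if t: "t \<in> \<Omega>" for t
        proof -
          have "f t * g t = (f \<omega> + (t - \<omega>) * p t) * g t" using pq(3) t by simp
          also have "\<dots> = f \<omega> * g t + (t - \<omega>) * (p t * g t)" by (simp add: algebra_simps)
          also have "f \<omega> * g t = f \<omega> * (g \<omega> + (t - \<omega>) * q t)" using pq(4) t by simp
          finally show ?thesis
            unfolding restrict_apply'[OF t] restrict_apply'[OF w] by (simp add: algebra_simps)
        qed
        ultimately show ?case by blast
      qed
    qed
  qed
qed (auto intro: gen_base)

lemma smooth_const: "(\<lambda>t\<in>\<Omega>. c) \<in> smooth_functions \<Omega>"
  using gen_const by (simp add: generated_smooth)

lemma smooth_id: "(\<lambda>t\<in>\<Omega>. t) \<in> smooth_functions \<Omega>"
  using gen_id by (simp add: generated_smooth)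

lemma smooth_add:
  "f \<in> smooth_functions \<Omega> \<Longrightarrow> g \<in> smooth_functions \<Omega> \<Longrightarrow> (\<lambda>t\<in>\<Omega>. f t + g t) \<in> smooth_functions \<Omega>"
  using gen_add by (simp add: generated_smooth)

lemma smooth_mult:
  "f \<in> smooth_functions \<Omega> \<Longrightarrow> g \<in> smooth_functions \<Omega> \<Longrightarrow> (\<lambda>t\<in>\<Omega>. f t * g t) \<in> smooth_functions \<Omega>"
  using gen_mult by (simp add: generated_smooth)

lemma smooth_scale: "f \<in> smooth_functions \<Omega> \<Longrightarrow> (\<lambda>t\<in>\<Omega>. c * f t) \<in> smooth_functions \<Omega>"
proof -
  assume "f \<in> smooth_functions \<Omega>"
  from smooth_mult[OF smooth_const[of c \<Omega>] this]
  show ?thesis by (simp cong: restrict_cong)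
qed

lemma fun_algebra_algebra: "algebra \<Z> (fun_algebra \<Z> \<Omega>)"
proof (rule algebraI)
  show "cring (fun_algebra \<Z> \<Omega>)"
  proof (rule cringI)
    show "abelian_group (fun_algebra \<Z> \<Omega>)"
    proof (rule abelian_groupI)
      fix f assume "f \<in> carrier (fun_algebra \<Z> \<Omega>)"
      then show "\<exists>g\<in>carrier (fun_algebra \<Z> \<Omega>). g \<oplus>\<^bsub>fun_algebra \<Z> \<Omega>\<^esub> f = \<zero>\<^bsub>fun_algebra \<Z> \<Omega>\<^esub>"
        by (intro bexI[of _ "\<lambda>t\<in>\<Omega>. - f t"]) (auto simp: fun_algebra_def cong: restrict_cong)
    qed (auto simp: fun_algebra_def ac_simps PiE_def extensional_restrict cong: restrict_cong)
    show "comm_monoid (fun_algebra \<Z> \<Omega>)"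
      by (rule comm_monoidI)
        (auto simp: fun_algebra_def ac_simps PiE_def extensional_restrict cong: restrict_cong)
  qed (auto simp: fun_algebra_def algebra_simps cong: restrict_cong)
qed (auto simp: fun_algebra_def algebra_simps int_is_cring PiE_def extensional_restrict cong: restrict_cong)

lemma fun_algebra_minus:
  assumes "f \<in> carrier (fun_algebra \<Z> \<Omega>)"
  shows "\<ominus>\<^bsub>fun_algebra \<Z> \<Omega>\<^esub> f = (\<lambda>t\<in>\<Omega>. - f t)"
proof -
  interpret algebra \<Z> "fun_algebra \<Z> \<Omega>" by (rule fun_algebra_algebra)
  have "(\<lambda>t\<in>\<Omega>. - f t) \<oplus>\<^bsub>fun_algebra \<Z> \<Omega>\<^esub> f = \<zero>\<^bsub>fun_algebra \<Z> \<Omega>\<^esub>"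
    by (auto simp: fun_algebra_def cong: restrict_cong)
  then show ?thesis using assms by (intro minus_equality) (auto simp: fun_algebra_def)
qed

definition function_subalgebra :: "int set \<Rightarrow> (int \<Rightarrow> int) set \<Rightarrow> (int, int \<Rightarrow> int) module" where
  "function_subalgebra \<Omega> F = (fun_algebra \<Z> \<Omega>)\<lparr>carrier := F\<rparr>"

lemma function_subalgebra_sel [simp]:
  "carrier (function_subalgebra \<Omega> F) = F"
  "f \<otimes>\<^bsub>function_subalgebra \<Omega> F\<^esub> g = (\<lambda>t\<in>\<Omega>. f t * g t)"
  "f \<oplus>\<^bsub>function_subalgebra \<Omega> F\<^esub> g = (\<lambda>t\<in>\<Omega>. f t + g t)"
  "\<one>\<^bsub>function_subalgebra \<Omega> F\<^esub> = (\<lambda>t\<in>\<Omega>. 1)"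
  "\<zero>\<^bsub>function_subalgebra \<Omega> F\<^esub> = (\<lambda>t\<in>\<Omega>. 0)"
  "r \<odot>\<^bsub>function_subalgebra \<Omega> F\<^esub> f = (\<lambda>t\<in>\<Omega>. r * f t)"
  by (simp_all add: function_subalgebra_def fun_algebra_def)

lemma subalg_smooth_functions: "subalg \<Z> (fun_algebra \<Z> \<Omega>) (smooth_functions \<Omega>)"
proof -
  interpret algebra \<Z> "fun_algebra \<Z> \<Omega>" by (rule fun_algebra_algebra)
  have sub: "smooth_functions \<Omega> \<subseteq> carrier (fun_algebra \<Z> \<Omega>)"
    using smooth_functions_extensional by (auto simp: fun_algebra_def PiE_def)
  have neg: "\<ominus>\<^bsub>fun_algebra \<Z> \<Omega>\<^esub> f \<in> smooth_functions \<Omega>" if "f \<in> smooth_functions \<Omega>" for f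
    using fun_algebra_minus[of f \<Omega>] sub that smooth_scale[OF that, of "-1"] by auto
  show ?thesis
    unfolding subalg_def
  proof
    show "submodule (smooth_functions \<Omega>) \<Z> (fun_algebra \<Z> \<Omega>)"
      by (rule submoduleI)
        (use sub neg in \<open>auto simp: fun_algebra_def intro: smooth_const smooth_add smooth_scale\<close>)
    show "subring (smooth_functions \<Omega>) (fun_algebra \<Z> \<Omega>)"
      by (rule subringI)
        (use sub neg in \<open>auto simp: fun_algebra_def intro: smooth_const smooth_add smooth_mult\<close>)
  qed
qed

lemma subalg_algebra:
  assumes "subalg \<Z> (fun_algebra \<Z> \<Omega>) F"
  shows "algebra \<Z> (function_subalgebra \<Omega> F)"
proof -
  interpret A: algebra \<Z> "fun_algebra \<Z> \<Omega>" by (rule fun_algebra_algebra)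
  have sm: "submodule F \<Z> (fun_algebra \<Z> \<Omega>)" and sr: "subring F (fun_algebra \<Z> \<Omega>)"
    using assms by (auto simp: subalg_def)
  have "module \<Z> (function_subalgebra \<Omega> F)"
    unfolding function_subalgebra_def by (rule submodule.submodule_is_module[OF sm A.module])
  moreover have "cring (function_subalgebra \<Omega> F)"
    unfolding function_subalgebra_def
    using A.subcring_iff[OF subringE(1)[OF sr]] A.subcringI'[OF sr] by simp
  ultimately show ?thesis
    by (intro algebra.intro algebra_axioms.intro) (auto simp: algebra_simps cong: restrict_cong)
qed

section \<open>The smooth structure on a set of integers\<close>

definition coordinate :: "int set \<Rightarrow> int \<Rightarrow> int" where
  "coordinate \<Omega> = (\<lambda>t\<in>\<Omega>. t)"

lemma subalg_int_algebra:
  "subalg \<Z> (fun_algebra \<Z> \<Omega>) F \<Longrightarrow> int_algebra (function_subalgebra \<Omega> F)"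
  by (simp add: int_algebra_def subalg_algebra)

lemma subalg_extensional:
  assumes "subalg \<Z> (fun_algebra \<Z> \<Omega>) F" "f \<in> F" shows "f \<in> extensional \<Omega>"
  using assms subringE(1)[of F "fun_algebra \<Z> \<Omega>"]
  by (auto simp: subalg_def fun_algebra_def PiE_def)

lemma function_shift:
  assumes F: "subalg \<Z> (fun_algebra \<Z> \<Omega>) F" and x: "coordinate \<Omega> \<in> F"
  shows "coordinate \<Omega> \<ominus>\<^bsub>function_subalgebra \<Omega> F\<^esub> \<omega> \<odot>\<^bsub>function_subalgebra \<Omega> F\<^esub> \<one>\<^bsub>function_subalgebra \<Omega> F\<^esub>
    = (\<lambda>t\<in>\<Omega>. t - \<omega>)"
proof -
  interpret int_algebra "function_subalgebra \<Omega> F" by (rule subalg_int_algebra[OF F])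
  show ?thesis
    using minus_eq_smult[of "coordinate \<Omega>" "\<omega> \<odot>\<^bsub>function_subalgebra \<Omega> F\<^esub> \<one>\<^bsub>function_subalgebra \<Omega> F\<^esub>"] x
      smult_carrier[OF one_closed, of \<omega>]
    by (simp add: coordinate_def cong: restrict_cong)
qed

lemma function_coordinate_algebra:
  assumes F: "subalg \<Z> (fun_algebra \<Z> \<Omega>) F" and x: "coordinate \<Omega> \<in> F" and inf: "infinite \<Omega>"
    and quot: "\<And>f \<omega>. f \<in> F \<Longrightarrow> \<omega> \<in> \<Omega> \<Longrightarrow> \<exists>g\<in>F. \<forall>t\<in>\<Omega>. f t = f \<omega> + (t - \<omega>) * g t"
  shows "coordinate_algebra (function_subalgebra \<Omega> F) (coordinate \<Omega>) \<Omega>"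
proof -
  interpret int_algebra "function_subalgebra \<Omega> F" by (rule subalg_int_algebra[OF F])
  show ?thesis
  proof unfold_locales
    fix \<omega> f assume w: "\<omega> \<in> \<Omega>" and "f \<in> carrier (function_subalgebra \<Omega> F)"
    then have f: "f \<in> F" by simp
    obtain g where g: "g \<in> F" "\<forall>t\<in>\<Omega>. f t = f \<omega> + (t - \<omega>) * g t" using quot[OF f w] by blast
    have "f = (\<lambda>t\<in>\<Omega>. f \<omega> + (t - \<omega>) * g t)"
    proof (rule extensionalityI[of f \<Omega>])
      show "f t = (\<lambda>t\<in>\<Omega>. f \<omega> + (t - \<omega>) * g t) t" if "t \<in> \<Omega>" for t
        unfolding restrict_apply'[OF that] using g(2) that by blast
    qed (use subalg_extensional[OF F f] in auto)
    also have "\<dots> = f \<omega> \<odot>\<^bsub>function_subalgebra \<Omega> F\<^esub> \<one>\<^bsub>function_subalgebra \<Omega> F\<^esub> \<oplus>\<^bsub>function_subalgebra \<Omega> F\<^esub>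
      (\<lambda>t\<in>\<Omega>. t - \<omega>) \<otimes>\<^bsub>function_subalgebra \<Omega> F\<^esub> g"
      by (simp cong: restrict_cong)
    finally show "\<exists>c. \<exists>q\<in>carrier (function_subalgebra \<Omega> F).
      f = c \<odot>\<^bsub>function_subalgebra \<Omega> F\<^esub> \<one>\<^bsub>function_subalgebra \<Omega> F\<^esub> \<oplus>\<^bsub>function_subalgebra \<Omega> F\<^esub>
        (coordinate \<Omega> \<ominus>\<^bsub>function_subalgebra \<Omega> F\<^esub> \<omega> \<odot>\<^bsub>function_subalgebra \<Omega> F\<^esub> \<one>\<^bsub>function_subalgebra \<Omega> F\<^esub>)
          \<otimes>\<^bsub>function_subalgebra \<Omega> F\<^esub> q"
      unfolding function_shift[OF F x] using g(1) by auto
  next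
    fix \<omega> g c assume w: "\<omega> \<in> \<Omega>"
      and eq: "c \<odot>\<^bsub>function_subalgebra \<Omega> F\<^esub> \<one>\<^bsub>function_subalgebra \<Omega> F\<^esub> =
        (coordinate \<Omega> \<ominus>\<^bsub>function_subalgebra \<Omega> F\<^esub> \<omega> \<odot>\<^bsub>function_subalgebra \<Omega> F\<^esub> \<one>\<^bsub>function_subalgebra \<Omega> F\<^esub>)
          \<otimes>\<^bsub>function_subalgebra \<Omega> F\<^esub> g"
    show "c = 0" using fun_cong[OF eq[unfolded function_shift[OF F x]], of \<omega>] w by simp
  qed (use x inf in auto)
qed

lemma function_ev:
  assumes C: "coordinate_algebra (function_subalgebra \<Omega> F) (coordinate \<Omega>) \<Omega>"
    and F: "subalg \<Z> (fun_algebra \<Z> \<Omega>) F" and f: "f \<in> F" and w: "\<omega> \<in> \<Omega>"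
  shows "coordinate_algebra.ev (function_subalgebra \<Omega> F) (coordinate \<Omega>) \<omega> f = f \<omega>"
proof -
  interpret coordinate_algebra "function_subalgebra \<Omega> F" "coordinate \<Omega>" \<Omega> by fact
  have x: "coordinate \<Omega> \<in> F" using x_carrier by simp
  obtain q where q: "f = ev \<omega> f \<odot>\<^bsub>function_subalgebra \<Omega> F\<^esub> \<one>\<^bsub>function_subalgebra \<Omega> F\<^esub> \<oplus>\<^bsub>function_subalgebra \<Omega> F\<^esub>
      shift \<omega> \<otimes>\<^bsub>function_subalgebra \<Omega> F\<^esub> q"
    using ev_expand[OF w, of f] f by auto
  have "f \<omega> = (ev \<omega> f \<odot>\<^bsub>function_subalgebra \<Omega> F\<^esub> \<one>\<^bsub>function_subalgebra \<Omega> F\<^esub> \<oplus>\<^bsub>function_subalgebra \<Omega> F\<^esub>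
      shift \<omega> \<otimes>\<^bsub>function_subalgebra \<Omega> F\<^esub> q) \<omega>"
    using fun_cong[OF q] .
  moreover have "shift \<omega> = (\<lambda>t\<in>\<Omega>. t - \<omega>)" unfolding shift_def by (rule function_shift[OF F x])
  ultimately show ?thesis using w by simp
qed

lemma function_points:
  assumes C: "coordinate_algebra (function_subalgebra \<Omega> F) (coordinate \<Omega>) \<Omega>"
    and F: "subalg \<Z> (fun_algebra \<Z> \<Omega>) F"
  shows "coordinate_algebra.points (function_subalgebra \<Omega> F) (coordinate \<Omega>) \<Omega> = point_ideal \<Z> F ` \<Omega>"
proof -
  interpret coordinate_algebra "function_subalgebra \<Omega> F" "coordinate \<Omega>" \<Omega> by fact
  show ?thesis
    unfolding points_def point_ideal_def
    using function_ev[OF C F] by (intro image_cong) (auto simp: pt_iff_ev)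
qed

lemma function_separated:
  assumes C: "coordinate_algebra (function_subalgebra \<Omega> F) (coordinate \<Omega>) \<Omega>"
    and F: "subalg \<Z> (fun_algebra \<Z> \<Omega>) F"
  shows "separated (function_subalgebra \<Omega> F) (point_ideal \<Z> F ` \<Omega>)"
proof -
  interpret coordinate_algebra "function_subalgebra \<Omega> F" "coordinate \<Omega>" \<Omega> by fact
  have "f = (\<lambda>t\<in>\<Omega>. 0)" if "f \<in> F" "\<forall>\<omega>\<in>\<Omega>. f \<omega> = 0" for f
    using that subalg_extensional[OF F] by (intro extensionalityI[of f \<Omega>]) auto
  then show ?thesis
    using separated_iff function_ev[OF C F] function_points[OF C F] by auto
qed

text \<open>
  The values of an element of any algebra with coordinate form a smooth function: the expansion
  \<open>y = y(\<omega>) e + (x - \<omega>) q\<close> at a point exhibits \<open>q\<close> as the difference quotient, and \<open>q\<close> lies in the same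
  algebra.
\<close>

lemma residue_function_smooth:
  assumes "coordinate_algebra M x \<Omega>" "y \<in> carrier M"
  shows "(\<lambda>\<omega>\<in>\<Omega>. coordinate_algebra.ev M x \<omega> y) \<in> smooth_functions \<Omega>"
proof -
  interpret coordinate_algebra M x \<Omega> by fact
  show ?thesis
  proof (rule smooth_functions_coinduct[where K = "(\<lambda>y. \<lambda>\<omega>\<in>\<Omega>. ev \<omega> y) ` carrier M"])
    fix f \<omega> assume "f \<in> (\<lambda>y. \<lambda>\<omega>\<in>\<Omega>. ev \<omega> y) ` carrier M" and w: "\<omega> \<in> \<Omega>"
    then obtain y where y: "y \<in> carrier M" "f = (\<lambda>\<omega>\<in>\<Omega>. ev \<omega> y)" by blast
    obtain q where q: "q \<in> carrier M" "y = ev \<omega> y \<odot>\<^bsub>M\<^esub> \<one>\<^bsub>M\<^esub> \<oplus>\<^bsub>M\<^esub> shift \<omega> \<otimes>\<^bsub>M\<^esub> q"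
      by (rule ev_expand[OF w y(1)])
    have "f t = f \<omega> + (t - \<omega>) * (\<lambda>\<omega>\<in>\<Omega>. ev \<omega> q) t" if t: "t \<in> \<Omega>" for t
    proof -
      have "ev t y = ev t (ev \<omega> y \<odot>\<^bsub>M\<^esub> \<one>\<^bsub>M\<^esub> \<oplus>\<^bsub>M\<^esub> shift \<omega> \<otimes>\<^bsub>M\<^esub> q)" using q(2) by simp
      also have "\<dots> = ev \<omega> y + (t - \<omega>) * ev t q" using q(1) t by simp
      finally show ?thesis unfolding y(2) restrict_apply'[OF t] restrict_apply'[OF w] .
    qed
    then show "\<exists>g\<in>(\<lambda>y. \<lambda>\<omega>\<in>\<Omega>. ev \<omega> y) ` carrier M. \<forall>t\<in>\<Omega>. f t = f \<omega> + (t - \<omega>) * g t"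
      using q(1) by blast
  qed (use assms(2) in auto)
qed

lemma smooth_functions_coordinate_algebra:
  assumes "infinite \<Omega>"
  shows "coordinate_algebra (function_subalgebra \<Omega> (smooth_functions \<Omega>)) (coordinate \<Omega>) \<Omega>"
proof (rule function_coordinate_algebra[OF subalg_smooth_functions _ assms])
  show "coordinate \<Omega> \<in> smooth_functions \<Omega>" unfolding coordinate_def by (rule smooth_id)
qed (use smooth_functions_quotient in metis)

text \<open>
  The target of a domination is an algebra with coordinate, so the values of any of its elements
  \<open>y\<close> form a smooth function \<open>f\<close>. Then \<open>y\<close> and \<open>\<phi>(f)\<close> have the same values, and they agree because
  the target is separated.
\<close>

lemma smooth_functions_maximal:
  assumes inf: "infinite \<Omega>"
  shows "separatedly_maximal \<Z> (function_subalgebra \<Omega> (smooth_functions \<Omega>))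
    (point_ideal \<Z> (smooth_functions \<Omega>) ` \<Omega>)"
  unfolding separatedly_maximal_def
proof (intro allI impI, elim conjE)
  let ?F = "smooth_functions \<Omega>"
  let ?M = "function_subalgebra \<Omega> ?F" and ?S = "point_ideal \<Z> (smooth_functions \<Omega>) ` \<Omega>"
  fix M' :: "(int, (int \<Rightarrow> int) set \<Rightarrow> int) module" and S' \<phi>
  assume sep: "separated M' S'" and dom: "domination \<Z> ?M ?S M' S' \<phi>"
    and onto: "preim ?M \<phi> ` S' = ?S"
  have C: "coordinate_algebra ?M (coordinate \<Omega>) \<Omega>" by (rule smooth_functions_coordinate_algebra[OF inf])
  note pts = function_points[OF C subalg_smooth_functions, symmetric]
  note D = domination_coordinate[OF C dom[unfolded pts] onto[unfolded pts]]
  interpret coordinate_hom ?M "coordinate \<Omega>" \<Omega> M' "\<phi> (coordinate \<Omega>)" \<phi> by (rule D(1))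
  have inj: "inj_on \<phi> (carrier ?M)" using dom unfolding domination_def by blast
  have "carrier M' \<subseteq> \<phi> ` carrier ?M"
  proof
    fix y assume y: "y \<in> carrier M'"
    define f where "f = (\<lambda>\<omega>\<in>\<Omega>. B.ev \<omega> y)"
    have f: "f \<in> ?F" unfolding f_def by (rule residue_function_smooth[OF B.coordinate_algebra_axioms y])
    have pf: "\<phi> f \<in> carrier M'" using hom_simps(1)[of f] f by simp
    have "B.ev \<omega> (y \<ominus>\<^bsub>M'\<^esub> \<phi> f) = 0" if w: "\<omega> \<in> \<Omega>" for \<omega>
    proof -
      have "B.ev \<omega> (\<phi> f) = f \<omega>"
        using ev_hom[OF w, of f] function_ev[OF C subalg_smooth_functions f w] f by simp
      also have "\<dots> = B.ev \<omega> y" using w by (simp add: f_def)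
      finally show ?thesis using w y pf by (simp add: B.minus_eq_smult)
    qed
    then have "y \<ominus>\<^bsub>M'\<^esub> \<phi> f = \<zero>\<^bsub>M'\<^esub>"
      using B.separated_iff sep D(2) y pf by simp
    then have "y = \<phi> f" using y pf B.r_right_minus_eq by simp
    then show "y \<in> \<phi> ` carrier ?M" using f by simp
  qed
  then have "bij_betw \<phi> (carrier ?M) (carrier M')"
    using inj hom_simps(1) by (auto simp: bij_betw_def)
  then show "C_iso \<Z> ?M ?S M' S' \<phi>" using C_iso_points D(2) by (simp add: pts)
qed

lemma smooth_functions_structure:
  assumes inf: "infinite \<Omega>" and abs: "absorbing \<Z> \<Omega>"
  shows "smooth_structure \<Z> \<Omega> (smooth_functions \<Omega>) (point_ideal \<Z> (smooth_functions \<Omega>) ` \<Omega>)"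
proof -
  let ?F = "smooth_functions \<Omega>"
  let ?M = "function_subalgebra \<Omega> ?F" and ?S = "point_ideal \<Z> (smooth_functions \<Omega>) ` \<Omega>"
  have C: "coordinate_algebra ?M (coordinate \<Omega>) \<Omega>" by (rule smooth_functions_coordinate_algebra[OF inf])
  interpret coordinate_algebra ?M "coordinate \<Omega>" \<Omega> by (rule C)
  note pts = function_points[OF C subalg_smooth_functions]
  have pt: "pt \<omega> = point_ideal \<Z> ?F \<omega>" if "\<omega> \<in> \<Omega>" for \<omega>
    using function_ev[OF C subalg_smooth_functions] that by (auto simp: pt_iff_ev point_ideal_def)
  have "gen_submodule \<Z> ?M {shift \<omega>} \<in> circ \<Z> ?M (point_ideal \<Z> ?F \<omega>)" if "\<omega> \<in> \<Omega>" for \<omega>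
    using shift_cyclic_circ[OF that] pt[OF that]
    unfolding gen_submodule_singleton[OF shift_carrier] by simp
  then show ?thesis
    unfolding smooth_structure_def function_subalgebra_def[symmetric] coordinate_def[symmetric] Let_def
    using abs subalg_smooth_functions smooth_pair_points pts x_carrier
      function_separated[OF C subalg_smooth_functions] smooth_functions_maximal[OF inf]
    by (simp add: shift_def)
qed

section \<open>Uniqueness of the smooth structure\<close>

text \<open>
  A copy of \<open>M\<close> along an injection, needed because maximality speaks about target algebras whose
  elements have the type \<open>'a set \<Rightarrow> int\<close>. The map \<open>inv_into UNIV j\<close> undoes \<open>j\<close>.
\<close>

definition transport_algebra ::
    "('a \<Rightarrow> 'b) \<Rightarrow> (int, 'a, 'n) module_scheme \<Rightarrow> (int, 'b) module" where
  "transport_algebra j M = \<lparr>carrier = j ` carrier M,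
     monoid.mult = (\<lambda>a b. j (inv_into UNIV j a \<otimes>\<^bsub>M\<^esub> inv_into UNIV j b)), one = j \<one>\<^bsub>M\<^esub>,
     zero = j \<zero>\<^bsub>M\<^esub>, add = (\<lambda>a b. j (inv_into UNIV j a \<oplus>\<^bsub>M\<^esub> inv_into UNIV j b)),
     module.smult = (\<lambda>r a. j (r \<odot>\<^bsub>M\<^esub> inv_into UNIV j a))\<rparr>"

context
  fixes j :: "'a \<Rightarrow> 'b" and M :: "(int, 'a, 'n) module_scheme"
  assumes inj: "inj j"
begin

lemma transport_sel [simp]:
  "carrier (transport_algebra j M) = j ` carrier M"
  "j a \<otimes>\<^bsub>transport_algebra j M\<^esub> j b = j (a \<otimes>\<^bsub>M\<^esub> b)"
  "\<one>\<^bsub>transport_algebra j M\<^esub> = j \<one>\<^bsub>M\<^esub>"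
  "\<zero>\<^bsub>transport_algebra j M\<^esub> = j \<zero>\<^bsub>M\<^esub>"
  "j a \<oplus>\<^bsub>transport_algebra j M\<^esub> j b = j (a \<oplus>\<^bsub>M\<^esub> b)"
  "r \<odot>\<^bsub>transport_algebra j M\<^esub> j a = j (r \<odot>\<^bsub>M\<^esub> a)"
  using inj by (simp_all add: transport_algebra_def)

lemma transport_hom: "j \<in> alg_hom \<Z> M (transport_algebra j M)"
  unfolding alg_hom_def by (auto intro!: ring_hom_memI)

lemma transport_int_algebra:
  assumes "int_algebra M" shows "int_algebra (transport_algebra j M)"
proof -
  interpret int_algebra M by fact
  have "algebra \<Z> (transport_algebra j M)"
  proof (rule algebraI)
    show "cring (transport_algebra j M)"
    proof (rule cringI)
      show "abelian_group (transport_algebra j M)"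
      proof (rule abelian_groupI)
        fix a assume "a \<in> carrier (transport_algebra j M)"
        then obtain y where y: "y \<in> carrier M" "a = j y" by auto
        then show "\<exists>b\<in>carrier (transport_algebra j M).
            b \<oplus>\<^bsub>transport_algebra j M\<^esub> a = \<zero>\<^bsub>transport_algebra j M\<^esub>"
          by (intro bexI[of _ "j (\<ominus>\<^bsub>M\<^esub> y)"]) (auto simp: l_neg)
      qed (auto simp: a_ac)
      show "comm_monoid (transport_algebra j M)"
        by (rule comm_monoidI) (auto simp: m_ac)
    qed (auto simp: l_distr)
  qed (auto simp: int_is_cring smult_add smult_add_right smult_mult smult_m_left)
  then show ?thesis by (simp add: int_algebra_def)
qed

lemma transport_coordinate_algebra:
  assumes "coordinate_algebra M x \<Omega>"
  shows "coordinate_algebra (transport_algebra j M) (j x) \<Omega>"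
proof -
  interpret coordinate_algebra M x \<Omega> by fact
  interpret T: int_algebra "transport_algebra j M" by (rule transport_int_algebra[OF int_algebra_axioms])
  have sh: "j x \<ominus>\<^bsub>transport_algebra j M\<^esub> \<omega> \<odot>\<^bsub>transport_algebra j M\<^esub> \<one>\<^bsub>transport_algebra j M\<^esub> = j (shift \<omega>)" for \<omega>
    using alg_hom_shift[OF int_algebra_axioms T.int_algebra_axioms transport_hom x_carrier]
    by (simp add: shift_def)
  show ?thesis
  proof unfold_locales
    fix \<omega> a assume w: "\<omega> \<in> \<Omega>" and "a \<in> carrier (transport_algebra j M)"
    then obtain y where y: "y \<in> carrier M" "a = j y" by auto
    obtain q where q: "q \<in> carrier M" "y = ev \<omega> y \<odot>\<^bsub>M\<^esub> \<one>\<^bsub>M\<^esub> \<oplus>\<^bsub>M\<^esub> shift \<omega> \<otimes>\<^bsub>M\<^esub> q"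
      by (rule ev_expand[OF w y(1)])
    show "\<exists>c. \<exists>q\<in>carrier (transport_algebra j M).
      a = c \<odot>\<^bsub>transport_algebra j M\<^esub> \<one>\<^bsub>transport_algebra j M\<^esub> \<oplus>\<^bsub>transport_algebra j M\<^esub>
        (j x \<ominus>\<^bsub>transport_algebra j M\<^esub> \<omega> \<odot>\<^bsub>transport_algebra j M\<^esub> \<one>\<^bsub>transport_algebra j M\<^esub>)
          \<otimes>\<^bsub>transport_algebra j M\<^esub> q"
      unfolding sh y(2) using q by (intro exI[of _ "ev \<omega> y"] bexI[of _ "j q"]) auto
  next
    fix \<omega> b c assume w: "\<omega> \<in> \<Omega>" and "b \<in> carrier (transport_algebra j M)"
      and eq: "c \<odot>\<^bsub>transport_algebra j M\<^esub> \<one>\<^bsub>transport_algebra j M\<^esub> =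
        (j x \<ominus>\<^bsub>transport_algebra j M\<^esub> \<omega> \<odot>\<^bsub>transport_algebra j M\<^esub> \<one>\<^bsub>transport_algebra j M\<^esub>)
          \<otimes>\<^bsub>transport_algebra j M\<^esub> b"
    then obtain q where q: "q \<in> carrier M" "b = j q" by auto
    have "c \<odot>\<^bsub>M\<^esub> \<one>\<^bsub>M\<^esub> = shift \<omega> \<otimes>\<^bsub>M\<^esub> q"
      using eq inj unfolding sh q(2) by (simp add: inj_eq)
    then show "c = 0" using proper[OF w q(1)] by (simp add: shift_def)
  qed (use infinite_points in auto)
qed

end

text \<open>
  By definition \<open>\<int>(x - \<omega>)\<close> generates the ideal of \<open>\<omega>\<close> in a smooth structure, so \<open>f - f(\<omega>)\<close> is a
  multiple of \<open>x - \<omega>\<close>.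
\<close>

lemma smooth_structure_coordinate_algebra:
  assumes S: "smooth_structure \<Z> \<Omega> F S" and inf: "infinite \<Omega>"
  shows "coordinate_algebra (function_subalgebra \<Omega> F) (coordinate \<Omega>) \<Omega>"
proof (rule function_coordinate_algebra)
  let ?M = "function_subalgebra \<Omega> F"
  show F: "subalg \<Z> (fun_algebra \<Z> \<Omega>) F" and x: "coordinate \<Omega> \<in> F"
    using S by (auto simp: smooth_structure_def Let_def coordinate_def)
  show "infinite \<Omega>" by fact
  interpret int_algebra ?M by (rule subalg_int_algebra[OF F])
  fix f \<omega> assume f: "f \<in> F" and w: "\<omega> \<in> \<Omega>"
  let ?s = "\<lambda>t\<in>\<Omega>. t - \<omega>"
  have "coordinate \<Omega> \<ominus>\<^bsub>?M\<^esub> \<omega> \<odot>\<^bsub>?M\<^esub> \<one>\<^bsub>?M\<^esub> \<in> carrier ?M"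
    using x smult_carrier[OF one_closed, of \<omega>] by (intro minus_closed) simp_all
  then have s: "?s \<in> carrier ?M" unfolding function_shift[OF F x] .
  have "\<forall>\<omega>\<in>\<Omega>. gen_submodule \<Z> ?M {coordinate \<Omega> \<ominus>\<^bsub>?M\<^esub> \<omega> \<odot>\<^bsub>?M\<^esub> \<one>\<^bsub>?M\<^esub>} \<in> circ \<Z> ?M (point_ideal \<Z> F \<omega>)"
    using S unfolding smooth_structure_def Let_def function_subalgebra_def coordinate_def by blast
  then have "gen_submodule \<Z> ?M {?s} \<in> circ \<Z> ?M (point_ideal \<Z> F \<omega>)"
    unfolding function_shift[OF F x] using w by blast
  then have pt: "PIdl\<^bsub>?M\<^esub> ?s = point_ideal \<Z> F \<omega>"
    unfolding gen_submodule_singleton[OF s] circ_def using underline_cyclic[OF s] by blast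
  define g where "g = (\<lambda>t\<in>\<Omega>. f t + (- f \<omega>) * 1)"
  have "g = f \<oplus>\<^bsub>?M\<^esub> (- f \<omega>) \<odot>\<^bsub>?M\<^esub> \<one>\<^bsub>?M\<^esub>" by (simp add: g_def cong: restrict_cong)
  moreover have "f \<oplus>\<^bsub>?M\<^esub> (- f \<omega>) \<odot>\<^bsub>?M\<^esub> \<one>\<^bsub>?M\<^esub> \<in> carrier ?M"
    using f by (intro a_closed smult_carrier one_closed) simp
  ultimately have "g \<in> F" by simp
  then have "g \<in> PIdl\<^bsub>?M\<^esub> ?s" unfolding pt using w by (simp add: point_ideal_def g_def)
  then obtain q where q: "q \<in> F" "g = ?s \<otimes>\<^bsub>?M\<^esub> q" using PIdl_iff[OF s] by auto
  have "f t = f \<omega> + (t - \<omega>) * q t" if "t \<in> \<Omega>" for t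
    using fun_cong[OF q(2), of t] that by (simp add: g_def)
  then show "\<exists>g\<in>F. \<forall>t\<in>\<Omega>. f t = f \<omega> + (t - \<omega>) * g t" using q(1) by blast
qed

text \<open>
  The functions of any smooth structure \<open>F\<close> have iterated difference quotients, so \<open>F\<close> is contained
  in the algebra of smooth functions. Both algebras have the same coordinate, so the inclusion is a
  domination; by maximality of \<open>F\<close> it is surjective.
\<close>

lemma smooth_structure_unique:
  assumes S: "smooth_structure \<Z> \<Omega> F S" and inf: "infinite \<Omega>"
  shows "F = smooth_functions \<Omega>"
proof -
  let ?M = "function_subalgebra \<Omega> F" and ?N = "function_subalgebra \<Omega> (smooth_functions \<Omega>)"
  have F: "subalg \<Z> (fun_algebra \<Z> \<Omega>) F" and SS: "S = point_ideal \<Z> F ` \<Omega>"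
    and max: "separatedly_maximal \<Z> ?M S"
    using S by (auto simp: smooth_structure_def Let_def function_subalgebra_def)
  have C: "coordinate_algebra ?M (coordinate \<Omega>) \<Omega>"
    by (rule smooth_structure_coordinate_algebra[OF S inf])
  have N: "coordinate_algebra ?N (coordinate \<Omega>) \<Omega>"
    by (rule smooth_functions_coordinate_algebra[OF inf])
  have sub: "F \<subseteq> smooth_functions \<Omega>"
  proof
    fix f assume f: "f \<in> F"
    have "(\<lambda>\<omega>\<in>\<Omega>. coordinate_algebra.ev ?M (coordinate \<Omega>) \<omega> f) \<in> smooth_functions \<Omega>"
      using residue_function_smooth[OF C] f by simp
    moreover have "(\<lambda>\<omega>\<in>\<Omega>. coordinate_algebra.ev ?M (coordinate \<Omega>) \<omega> f) = f"
      using subalg_extensional[OF F f] function_ev[OF C F f]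
      by (intro extensionalityI[of _ \<Omega>]) auto
    ultimately show "f \<in> smooth_functions \<Omega>" by simp
  qed
  \<comment> \<open>Any injection into the type of target algebras would do.\<close>
  define j :: "(int \<Rightarrow> int) \<Rightarrow> ((int \<Rightarrow> int) set \<Rightarrow> int)" where "j f = (\<lambda>X. if f \<in> X then 1 else 0)" for f
  have j: "inj j"
  proof (rule injI)
    fix f g assume "j f = j g"
    from fun_cong[OF this, of "{f}"] show "f = g" by (simp add: j_def split: if_splits)
  qed
  let ?T = "transport_algebra j ?N"
  have T: "coordinate_algebra ?T (j (coordinate \<Omega>)) \<Omega>" by (rule transport_coordinate_algebra[OF j N])
  interpret T: coordinate_algebra ?T "j (coordinate \<Omega>)" \<Omega> by (rule T)
  interpret N: coordinate_hom ?N "coordinate \<Omega>" \<Omega> ?T "j (coordinate \<Omega>)" j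
    using N T transport_hom[OF j] by (simp add: coordinate_hom_def coordinate_hom_axioms_def)
  have hom: "j \<in> alg_hom \<Z> ?M ?T"
    unfolding alg_hom_def
    by (auto intro!: ring_hom_memI simp: subsetD[OF sub] transport_algebra_def inv_f_f[OF j])
  interpret H: coordinate_hom ?M "coordinate \<Omega>" \<Omega> ?T "j (coordinate \<Omega>)" j
    using C T hom by (simp add: coordinate_hom_def coordinate_hom_axioms_def)
  have "separated ?N N.A.points"
    using function_separated[OF N subalg_smooth_functions] function_points[OF N subalg_smooth_functions] by simp
  then have sepN: "\<forall>y\<in>carrier ?N. (\<forall>\<omega>\<in>\<Omega>. N.A.ev \<omega> y = 0) \<longrightarrow> y = \<zero>\<^bsub>?N\<^esub>"
    using N.A.separated_iff by blast
  have "separated ?T T.points"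
    unfolding T.separated_iff
  proof (intro ballI impI)
    fix a assume "a \<in> carrier ?T" and 0: "\<forall>\<omega>\<in>\<Omega>. T.ev \<omega> a = 0"
    then obtain y where y: "y \<in> carrier ?N" "a = j y" by (auto simp: transport_sel(1)[OF j])
    have "\<forall>\<omega>\<in>\<Omega>. N.A.ev \<omega> y = 0" using 0 N.ev_hom[OF _ y(1)] y(2) by simp
    then have "y = \<zero>\<^bsub>?N\<^esub>" using sepN y(1) by blast
    then show "a = \<zero>\<^bsub>?T\<^esub>" using y(2) by (simp add: transport_sel(4)[OF j])
  qed
  moreover have "domination \<Z> ?M H.A.points ?T T.points j"
    by (rule H.domination_points) (rule inj_on_subset[OF j subset_UNIV])
  ultimately have target: "smooth_pair \<Z> ?T T.points \<and> separated ?T T.points \<and>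
      domination \<Z> ?M H.A.points ?T T.points j \<and> preim ?M j ` T.points = H.A.points"
    using T.smooth_pair_points H.preim_points by simp
  have "S = H.A.points" using function_points[OF C F] SS by simp
  then have "C_iso \<Z> ?M H.A.points ?T T.points j"
    using max[unfolded separatedly_maximal_def, rule_format, of ?T T.points j] target by simp
  then obtain \<psi> where \<psi>: "C_hom \<Z> ?T T.points ?M H.A.points \<psi>" "\<forall>y\<in>carrier ?T. j (\<psi> y) = y"
    unfolding C_iso_def by blast
  have "smooth_functions \<Omega> \<subseteq> F"
  proof
    fix f assume f: "f \<in> smooth_functions \<Omega>"
    then have jf: "j f \<in> carrier ?T" by (simp add: transport_sel(1)[OF j])
    then have "\<psi> (j f) \<in> F" using \<psi>(1) alg_homD(1)[of \<psi> ?T ?M] by (simp add: C_hom_def)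
    moreover have "\<psi> (j f) = f" using bspec[OF \<psi>(2) jf] by (simp add: inj_eq[OF j])
    ultimately show "f \<in> F" by simp
  qed
  then show ?thesis using sub by simp
qed

theorem C_infinity_eq:
  assumes "infinite \<Omega>" "absorbing \<Z> \<Omega>"
  shows "C_infinity \<Z> \<Omega> = smooth_functions \<Omega>"
  unfolding C_infinity_def
  using smooth_functions_structure[OF assms] smooth_structure_unique[OF _ assms(1)]
  by (intro the_equality) blast+

section \<open>Smooth functions as series of polynomials\<close>

text \<open>
  At each point of \<open>\<Omega>\<close> the order of vanishing of \<open>p\<^sub>n\<close> tends to infinity. The case \<open>p n = 0\<close> is
  separate because \<open>order \<omega> 0\<close> is not a meaningful number.
\<close>

definition root_order_tends :: "int set \<Rightarrow> (nat \<Rightarrow> int poly) \<Rightarrow> bool" where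
  "root_order_tends \<Omega> p \<longleftrightarrow>
     (\<forall>\<omega>\<in>\<Omega>. \<forall>r. \<forall>\<^sub>\<infinity>n. p n = 0 \<or> r \<le> order \<omega> (p n))"

lemma order_quotient_linear:
  fixes p q :: "int poly"
  assumes "p = [:- \<omega>, 1:] * q" "r \<le> order \<omega>' p" "p \<noteq> 0"
  shows "r - 1 \<le> order \<omega>' q"
proof -
  have "order \<omega>' p = order \<omega>' [:- \<omega>, 1:] + order \<omega>' q"
    using assms(3) unfolding assms(1) by (rule order_mult)
  moreover have "order \<omega>' [:- \<omega>, 1:] \<le> 1"
    using order_degree[of "[:- \<omega>, 1:]" \<omega>'] by simp
  ultimately show ?thesis using assms(2) by simp
qed

text \<open>
  For all but finitely many \<open>n\<close> the polynomial \<open>p\<^sub>n\<close> vanishes at \<open>\<omega>\<close>, and synthetic division is then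
  division by \<open>X - \<omega>\<close>. This lowers the order at each point by at most one.
\<close>

lemma root_order_tends_synthetic_div:
  assumes "root_order_tends \<Omega> p" "\<omega> \<in> \<Omega>"
  shows "root_order_tends \<Omega> (\<lambda>n. synthetic_div (p n) \<omega>)"
  unfolding root_order_tends_def
proof (intro ballI allI)
  fix \<omega>' r assume w': "\<omega>' \<in> \<Omega>"
  have "\<forall>\<^sub>\<infinity>n. p n = 0 \<or> 1 \<le> order \<omega> (p n)" "\<forall>\<^sub>\<infinity>n. p n = 0 \<or> Suc r \<le> order \<omega>' (p n)"
    using assms w' by (auto simp: root_order_tends_def)
  then show "\<forall>\<^sub>\<infinity>n. synthetic_div (p n) \<omega> = 0 \<or> r \<le> order \<omega>' (synthetic_div (p n) \<omega>)"
  proof eventually_elim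
    case (elim n)
    show ?case
    proof (cases "p n = 0")
      case False
      then have "poly (p n) \<omega> = 0" using elim(1) by (metis One_nat_def not_less_eq_eq order_root zero_le order_0I le_zero_eq)
      then have "p n = [:- \<omega>, 1:] * synthetic_div (p n) \<omega>"
        using synthetic_div_correct'[of \<omega> "p n"] by simp
      then show ?thesis using order_quotient_linear[of "p n" \<omega> _ "Suc r" \<omega>'] elim(2) False by simp
    qed simp
  qed
qed

lemma root_order_tends_finite:
  assumes "root_order_tends \<Omega> p" "\<omega> \<in> \<Omega>"
  shows "finite {n. poly (p n) \<omega> \<noteq> 0}"
proof -
  have "\<forall>\<^sub>\<infinity>n. p n = 0 \<or> 1 \<le> order \<omega> (p n)" using assms by (auto simp: root_order_tends_def)
  then have "\<forall>\<^sub>\<infinity>n. poly (p n) \<omega> = 0"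
    by eventually_elim (metis One_nat_def not_less_eq_eq order_root zero_le order_0I le_zero_eq poly_0)
  then show ?thesis by (simp add: eventually_cofinite)
qed

text \<open>
  Difference quotients are taken term by term, and the series of quotients is of the same kind.
  The sums extend over the finitely many nonzero values, so that no convergence is involved.
\<close>

lemma polynomial_series_smooth:
  assumes "root_order_tends \<Omega> p"
  shows "(\<lambda>t\<in>\<Omega>. \<Sum>n | poly (p n) t \<noteq> 0. poly (p n) t) \<in> smooth_functions \<Omega>"
proof (rule smooth_functions_coinduct[where
      K = "{\<lambda>t\<in>\<Omega>. \<Sum>n | poly (p n) t \<noteq> 0. poly (p n) t |p. root_order_tends \<Omega> p}"])
  fix f \<omega> assume "f \<in> {\<lambda>t\<in>\<Omega>. \<Sum>n | poly (p n) t \<noteq> 0. poly (p n) t |p. root_order_tends \<Omega> p}"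
    and w: "\<omega> \<in> \<Omega>"
  then obtain p where p: "root_order_tends \<Omega> p" "f = (\<lambda>t\<in>\<Omega>. \<Sum>n | poly (p n) t \<noteq> 0. poly (p n) t)" by blast
  define q where "q = (\<lambda>n. synthetic_div (p n) \<omega>)"
  have q: "root_order_tends \<Omega> q" using root_order_tends_synthetic_div[OF p(1) w] by (simp add: q_def)
  have eq: "poly (p n) t = poly (p n) \<omega> + (t - \<omega>) * poly (q n) t" for n t
    using arg_cong[OF synthetic_div_correct'[of \<omega> "p n"], of "\<lambda>p. poly p t"]
    by (simp add: q_def algebra_simps)
  have "f t = f \<omega> + (t - \<omega>) * (\<lambda>t\<in>\<Omega>. \<Sum>n | poly (q n) t \<noteq> 0. poly (q n) t) t" if t: "t \<in> \<Omega>" for t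
  proof -
    let ?N = "{n. poly (p n) t \<noteq> 0} \<union> {n. poly (p n) \<omega> \<noteq> 0} \<union> {n. poly (q n) t \<noteq> 0}"
    have fin: "finite ?N" using root_order_tends_finite p(1) q t w by blast
    have "(\<Sum>n | poly (p n) t \<noteq> 0. poly (p n) t) = (\<Sum>n\<in>?N. poly (p n) t)"
      by (rule sum.mono_neutral_left[OF fin]) auto
    also have "\<dots> = (\<Sum>n\<in>?N. poly (p n) \<omega> + (t - \<omega>) * poly (q n) t)"
      by (rule sum.cong[OF refl]) (rule eq)
    also have "\<dots> = (\<Sum>n\<in>?N. poly (p n) \<omega>) + (t - \<omega>) * (\<Sum>n\<in>?N. poly (q n) t)"
      by (simp add: sum.distrib sum_distrib_left)
    also have "(\<Sum>n\<in>?N. poly (p n) \<omega>) = (\<Sum>n | poly (p n) \<omega> \<noteq> 0. poly (p n) \<omega>)"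
      by (rule sum.mono_neutral_right[OF fin]) auto
    also have "(\<Sum>n\<in>?N. poly (q n) t) = (\<Sum>n | poly (q n) t \<noteq> 0. poly (q n) t)"
      by (rule sum.mono_neutral_right[OF fin]) auto
    finally show ?thesis unfolding p(2) restrict_apply'[OF t] restrict_apply'[OF w] .
  qed
  then show "\<exists>g\<in>{\<lambda>t\<in>\<Omega>. \<Sum>n | poly (p n) t \<noteq> 0. poly (p n) t |p. root_order_tends \<Omega> p}.
      \<forall>t\<in>\<Omega>. f t = f \<omega> + (t - \<omega>) * g t"
    using q by blast
qed (use assms in \<open>auto simp del: restrict_apply\<close>)

section \<open>The function z is smooth\<close>

definition z_poly :: "nat \<Rightarrow> int poly" where
  "z_poly n = [:2 * (\<Prod>m=2..n. 1 + 2 * (\<Prod>k=2..m. int k ^ (2 * m ^ m))):] *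
     (\<Prod>k=1..n + 1. ([:int k ^ (2 * (n + 1) ^ n):] - [:0, 1:] ^ (2 * (n + 1) ^ n)) ^ (n + 1))"

lemma poly_z_poly: "poly (z_poly n) t = z_term n t"
  by (simp add: z_poly_def z_term_def poly_prod poly_power)

text \<open>
  The exponents of \<open>k\<close> and \<open>t\<close> are even, so the factor with \<open>k = \<bar>\<omega>\<bar>\<close> vanishes at \<open>\<omega>\<close>, and it
  occurs to the power \<open>n + 1\<close>. For \<open>\<omega> = 0\<close> there is no such factor, which is where the extension to
  the origin breaks down.
\<close>

lemma z_poly_order:
  assumes "\<omega> \<noteq> 0" "\<bar>\<omega>\<bar> \<le> int (n + 1)" "z_poly n \<noteq> 0"
  shows "n + 1 \<le> order \<omega> (z_poly n)"
proof -
  let ?e = "2 * (n + 1) ^ n"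
  define k where "k = nat \<bar>\<omega>\<bar>"
  let ?f = "\<lambda>k. [:int k ^ ?e:] - [:0, 1:] ^ ?e"
  have k: "k \<in> {1..n + 1}" using assms(1,2) by (auto simp: k_def)
  have "int k ^ ?e = \<omega> ^ ?e" by (simp add: k_def power_even_abs)
  then have "poly (?f k) \<omega> = 0" by (simp add: poly_power)
  then have "[:- \<omega>, 1:] dvd ?f k" by (rule poly_eq_0_iff_dvd[THEN iffD1])
  then have "[:- \<omega>, 1:] ^ (n + 1) dvd ?f k ^ (n + 1)" by (rule dvd_power_same)
  also have "\<dots> dvd (\<Prod>k=1..n + 1. ?f k ^ (n + 1))" by (rule dvd_prodI[OF _ k]) simp
  also have "\<dots> dvd z_poly n" unfolding z_poly_def by (rule dvd_triv_right)
  finally show ?thesis using order_divides assms(3) by blast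
qed

lemma z_term_eq_0:
  assumes "t \<noteq> 0" "\<bar>t\<bar> \<le> int (n + 1)" shows "z_term n t = 0"
  using z_poly_order[OF assms] order_root[of "z_poly n" t] poly_z_poly[of n t] by fastforce

lemma z_fun_eq_sum:
  assumes "t \<noteq> 0" "\<bar>t\<bar> \<le> int N + 2"
  shows "z_fun t = (1 - t ^ 2) + (\<Sum>n<N. z_term (Suc n) t)"
proof -
  have "(\<Sum>n. z_term (Suc n) t) = (\<Sum>n<N. z_term (Suc n) t)"
    by (rule suminf_finite) (use assms in \<open>auto intro!: z_term_eq_0\<close>)
  then show ?thesis using assms(1) by (simp add: z_fun_def)
qed

text \<open>
  Here \<open>1 - t\<^sup>2\<close> takes the place of the term with index \<open>0\<close>, which the series defining \<open>z\<close> omits.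
\<close>

lemma z_smooth: "z_fun \<in> smooth_functions (UNIV - {0})"
proof -
  define p where "p n = (if n = 0 then [:1, 0, - 1:] else z_poly n)" for n
  have "root_order_tends (UNIV - {0}) p"
    unfolding root_order_tends_def
  proof (intro ballI allI)
    fix \<omega> :: int and r :: nat assume w: "\<omega> \<in> UNIV - {0}"
    show "\<forall>\<^sub>\<infinity>n. p n = 0 \<or> r \<le> order \<omega> (p n)"
      unfolding cofinite_eq_sequentially eventually_sequentially
    proof (intro exI[of _ "r + nat \<bar>\<omega>\<bar> + 1"] allI impI)
      fix n assume n: "r + nat \<bar>\<omega>\<bar> + 1 \<le> n"
      then have "\<bar>\<omega>\<bar> \<le> int (n + 1)" "r \<le> n + 1" "n \<noteq> 0" by auto
      then show "p n = 0 \<or> r \<le> order \<omega> (p n)"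
        using z_poly_order[of \<omega> n] w by (auto simp: p_def)
    qed
  qed
  note S = polynomial_series_smooth[OF this]
  have "(\<lambda>t\<in>UNIV - {0}. \<Sum>n | poly (p n) t \<noteq> 0. poly (p n) t) = z_fun"
  proof (rule extensionalityI[of _ "UNIV - {0}"])
    fix t :: int assume t: "t \<in> UNIV - {0}"
    let ?N = "nat \<bar>t\<bar>"
    have "poly (p n) t = 0" if "\<not> n < Suc ?N" for n
    proof -
      have "\<bar>t\<bar> \<le> int (n + 1)" "n \<noteq> 0" using that by auto
      then show ?thesis using z_term_eq_0[of t n] t by (simp add: p_def poly_z_poly)
    qed
    then have "{n. poly (p n) t \<noteq> 0} \<subseteq> {..<Suc ?N}" by blast
    then have "(\<Sum>n | poly (p n) t \<noteq> 0. poly (p n) t) = (\<Sum>n<Suc ?N. poly (p n) t)"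
      by (intro sum.mono_neutral_left) auto
    also have "\<dots> = z_fun t"
      unfolding sum.lessThan_Suc_shift using t z_fun_eq_sum[of t ?N]
      by (simp add: p_def poly_z_poly power2_eq_square)
    finally show "(\<lambda>t\<in>UNIV - {0}. \<Sum>n | poly (p n) t \<noteq> 0. poly (p n) t) t = z_fun t" using t by simp
  qed (simp_all only: restrict_extensional z_fun_def)
  then show ?thesis using S by simp
qed

section \<open>The function z does not extend\<close>

text \<open>
  With these numbers the coefficient in front of the \<open>n\<close>-th term of the series is \<open>2 P\<^sub>n\<close>, where
  \<open>P\<^sub>n = (1 + p\<^sub>2) \<cdots> (1 + p\<^sub>n)\<close>.
\<close>

definition p_factor :: "nat \<Rightarrow> int" where
  "p_factor m = 2 * (\<Prod>k=2..m. int k ^ (2 * m ^ m))"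

definition partial_product :: "nat \<Rightarrow> int" where
  "partial_product n = (\<Prod>m=2..n. 1 + p_factor m)"

text \<open>
  At \<open>t = 0\<close> the exponents combine: \<open>(k\<^sup>e)\<^sup>n\<^sup>+\<^sup>1\<close> with \<open>e = 2(n+1)\<^sup>n\<close> is the power of \<open>k\<close> that occurs in
  \<open>p\<^sub>n\<^sub>+\<^sub>1\<close>. In this form the sum of the values at \<open>0\<close> telescopes, by \<open>P\<^sub>n + P\<^sub>n p\<^sub>n\<^sub>+\<^sub>1 = P\<^sub>n\<^sub>+\<^sub>1\<close>.
\<close>

lemma z_term_0: "z_term (Suc n) 0 = partial_product (Suc n) * p_factor (Suc (Suc n))"
proof -
  let ?n = "Suc n" let ?e = "2 * (?n + 1) ^ ?n"
  have e: "?e * (?n + 1) = 2 * (?n + 1) ^ (?n + 1)"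
    by (simp only: power_add power_one_right mult.assoc)
  have "(int k ^ ?e - 0 ^ ?e) ^ (?n + 1) = int k ^ (2 * (?n + 1) ^ (?n + 1))" for k
  proof -
    have "(0::int) ^ ?e = 0" by (simp add: power_0_left)
    then have "(int k ^ ?e - 0 ^ ?e) ^ (?n + 1) = (int k ^ ?e) ^ (?n + 1)" by (simp only: diff_zero)
    then show ?thesis by (simp only: power_mult[symmetric] e)
  qed
  then have "(\<Prod>k=1..?n + 1. (int k ^ ?e - 0 ^ ?e) ^ (?n + 1)) = (\<Prod>k=1..?n + 1. int k ^ (2 * (?n + 1) ^ (?n + 1)))"
    by (simp only:)
  also have "\<dots> = (\<Prod>k=2..?n + 1. int k ^ (2 * (?n + 1) ^ (?n + 1)))"
    by (subst prod.atLeast_Suc_atMost) (simp_all add: numeral_2_eq_2)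
  finally show ?thesis
    unfolding z_term_def partial_product_def p_factor_def by (simp only: mult_ac Suc_eq_plus1)
qed

lemma sum_z_term_0: "1 + (\<Sum>n<N. z_term (Suc n) 0) = partial_product (Suc N)"
proof (induction N)
  case 0
  show ?case by (simp add: partial_product_def)
next
  case (Suc N)
  have "partial_product (Suc (Suc N)) = partial_product (Suc N) * (1 + p_factor (Suc (Suc N)))"
    unfolding partial_product_def by (subst prod.nat_ivl_Suc') (simp_all add: mult.commute)
  then show ?case using Suc by (simp add: z_term_0 algebra_simps)
qed

text \<open>
  At \<open>t = T\<close> the series stops before the term with index \<open>T - 1\<close>. Modulo \<open>T\<close>, the remaining
  polynomials may be evaluated at \<open>0\<close> instead of \<open>T\<close>, where their sum telescopes.
\<close>

lemma z_fun_cong: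
  assumes "T \<ge> 2"
  shows "int T dvd z_fun (int T) - partial_product (T - 1)"
proof -
  define N where "N = T - 2"
  have T: "T = N + 2" using assms by (simp add: N_def)
  have d: "int T dvd z_term n (int T) - z_term n 0" for n
  proof -
    have "z_term n (int T) - z_term n 0 = int T * poly (synthetic_div (z_poly n) 0) (int T)"
      using arg_cong[OF synthetic_div_correct'[of 0 "z_poly n"], of "\<lambda>p. poly p (int T)"]
      by (simp add: poly_z_poly[symmetric])
    then show ?thesis by simp
  qed
  have "z_fun (int T) - partial_product (T - 1) =
      - (int T ^ 2) + (\<Sum>n<N. z_term (Suc n) (int T) - z_term (Suc n) 0)"
    using z_fun_eq_sum[of "int T" N] sum_z_term_0[of N] T by (simp add: sum_subtractf)
  also have "int T dvd \<dots>" by (intro dvd_add dvd_sum d) simp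
  finally show ?thesis .
qed

text \<open>
  The value \<open>c\<close> of an extension at \<open>0\<close> is congruent to \<open>z(T)\<close>, hence to \<open>P\<close> with index \<open>T - 1\<close>,
  modulo every \<open>T \<ge> 2\<close>. Choosing \<open>T = 1 + p\<^sub>m\<close>, which is a factor of that product, shows that
  \<open>c\<close> is divisible by arbitrarily large numbers, so \<open>c = 0\<close>. But \<open>T = 2\<close> gives that \<open>c\<close> is odd.
\<close>

lemma z_no_extension:
  "\<not> (\<exists>zbar \<in> smooth_functions UNIV. restrict zbar (UNIV - {0}) = z_fun)"
proof
  assume "\<exists>zbar \<in> smooth_functions UNIV. restrict zbar (UNIV - {0}) = z_fun"
  then obtain y where y: "y \<in> smooth_functions UNIV" "restrict y (UNIV - {0}) = z_fun" by blast
  obtain g where g: "\<And>t. y t = y 0 + (t - 0) * g t"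
    using smooth_functions_quotient[OF y(1), of 0] by auto
  have cong: "int T dvd y 0 - partial_product (T - 1)" if T: "T \<ge> 2" for T
  proof -
    have yz: "y (int T) = z_fun (int T)" using T fun_cong[OF y(2), of "int T"] by simp
    have "int T dvd y (int T) - y 0" using g[of "int T"] by simp
    with z_fun_cong[OF T]
    have "int T dvd (z_fun (int T) - partial_product (T - 1)) - (y (int T) - y 0)"
      by (rule dvd_diff)
    then show ?thesis using yz by simp
  qed
  have p_ge: "int m \<le> p_factor m" if "m \<ge> 2" for m
  proof -
    have "int m \<le> int m ^ (2 * m ^ m)" using that by (intro self_le_power) auto
    also have "int m ^ (2 * m ^ m) dvd (\<Prod>k=2..m. int k ^ (2 * m ^ m))"
      using that by (intro dvd_prodI) auto
    then have "int m ^ (2 * m ^ m) \<le> (\<Prod>k=2..m. int k ^ (2 * m ^ m))"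
      by (rule zdvd_imp_le) (auto intro!: prod_pos)
    finally show ?thesis using that unfolding p_factor_def by simp
  qed
  have "1 + p_factor m dvd y 0" if m: "m \<ge> 2" for m
  proof -
    define T where "T = nat (1 + p_factor m)"
    have T: "int T = 1 + p_factor m" "m \<le> T - 1" "T \<ge> 2" using p_ge[OF m] m by (auto simp: T_def)
    have "1 + p_factor m dvd partial_product (T - 1)"
      unfolding partial_product_def using m T(2) by (intro dvd_prodI) auto
    then show ?thesis using dvd_add[OF cong[OF T(3), unfolded T(1)]] by (metis diff_add_cancel)
  qed
  moreover have "\<exists>m\<ge>2. \<bar>y 0\<bar> < 1 + p_factor m"
    using p_ge[of "nat \<bar>y 0\<bar> + 2"] by (intro exI[of _ "nat \<bar>y 0\<bar> + 2"]) auto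
  ultimately obtain m where "\<bar>y 0\<bar> < 1 + p_factor m" "1 + p_factor m dvd y 0" by blast
  then have "y 0 = 0" using dvd_imp_le_int[of "y 0" "1 + p_factor m"] by linarith
  then show False using cong[of 2] by (simp add: partial_product_def)
qed

lemma absorbing_UNIV: "absorbing \<Z> UNIV"
  by (auto simp: absorbing_def absorbing_at_def intro!: exI[of _ 1])

lemma absorbing_nonzero: "absorbing \<Z> (UNIV - {0})"
  unfolding absorbing_def absorbing_at_def
proof (intro conjI ballI impI)
  fix l a :: int assume "l \<in> UNIV - {0}"
  then show "\<exists>b\<in>carrier \<Z>. a \<noteq> \<zero>\<^bsub>\<Z>\<^esub> \<longrightarrow>
      a \<otimes>\<^bsub>\<Z>\<^esub> b \<noteq> \<zero>\<^bsub>\<Z>\<^esub> \<and> l \<oplus>\<^bsub>\<Z>\<^esub> b \<otimes>\<^bsub>\<Z>\<^esub> a \<in> UNIV - {0}"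
    by (intro bexI[of _ "if l + a = 0 then 2 else 1"]) auto
qed auto

theorem proposition8p2:
  shows "absorbing \<Z> (UNIV - {0}) \<and>
    z_fun \<in> C_infinity \<Z> (UNIV - {0}) \<and>
    \<not> (\<exists>zbar \<in> C_infinity \<Z> UNIV. restrict zbar (UNIV - {0}) = z_fun)"
  using z_smooth z_no_extension absorbing_nonzero
    C_infinity_eq[OF _ absorbing_nonzero] C_infinity_eq[OF _ absorbing_UNIV]
  by (simp add: infinite_UNIV_int)

end
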